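(* Assume the category $\mathbf{GMet}$ has discrete finite products. Then the forgetful functor $U_\emptyset:\mathbf{QAlg}(\Sigma)\to\mathbf{GMet}$, sending $(A,d_A,\{op^A\}_{op\in\Sigma})$ to $(A,d_A)$ and acting as identity on morphisms, is strictly monadic.
   Context: Fix a signature $\Sigma$: a set of operation symbols $op$ each with a finite arity $ar(op)\in\mathbb N$. A fuzzy relation space is a pair $(A,d_A)$ with $A$ a set and $d_A:A\times A\to[0,1]$; a map $f:(A,d_A)\to(B,d_B)$ is nonexpansive if $d_B(f(a),f(a'))\le d_A(a,a')$ for all $a,a'$. Fix a set $\mathcal H$ of Horn implications $\forall\vec x.(F_1\wedge\dots\wedge F_n\Rightarrow G)$ with atomic formulas of the form $x=y$ or $d(x,y)\le\epsilon$ ($\epsilon\in[0,1]$); $\mathbf{GMet}$ is the full subcategory of the category of fuzzy relation spaces and nonexpansive maps whose objects satisfy all implications in $\mathcal H$. Let $U_{\mathbf{GMet}\to\mathbf{Set}}$ be the forgetful functor. A quantitative algebra is $(A,d_A,\{op^A\}_{op\in\Sigma})$ with $(A,d_A)$ a $\mathbf{GMet}$ space and arbitrary functions $op^A:A^{ar(op)}\to A$ (not required nonexpansive); a homomorphism is a nonexpansive map $f$ with $f(op^A(a_1,\dots,a_n))=op^B(f(a_1),\dots,f(a_n))$. $\mathbf{QAlg}(\Sigma)$ is the category of quantitative algebras and homomorphisms. A functor $L:\mathbf{GMet}\to\mathbf{GMet}$ is a lifting of the $n$-ary product if $U_{\mathbf{GMet}\to\mathbf{Set}}\circ L=(-)^n\circ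 U_{\mathbf{GMet}\to\mathbf{Set}}$, i.e. $L(A,d_A)=(A^n,L(d_A))$ for some fuzzy relation $L(d_A)$ on $A^n$ and $L(f)(a_1,\dots,a_n)=(f(a_1),\dots,f(a_n))$. It is a discrete lifting if moreover, for all $\mathbf{GMet}$ spaces $(A,d_A),(B,d_B)$, every function $f:A^n\to B$ is nonexpansive as a map $(A^n,L(d_A))\to(B,d_B)$. $\mathbf{GMet}$ has discrete finite products if for every $n\in\mathbb N$ there exists a discrete lifting of the $n$-ary product. A functor $U:\mathcal D\to\mathcal C$ is strictly monadic if it has a left adjoint $F$ such that the canonical comparison functor $K:\mathcal D\to\mathbf{EM}(UF)$, into the Eilenberg–Moore category of algebras of the monad $UF$ induced by $F\dashv U$, is an isomorphism of categories. *)

theory Defs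
  imports Complex_Main "HOL-Library.FuncSet" "HOL-Library.Countable_Set" "HOL-Library.Equipollence"
begin

section \<open>Categories, adjunctions, monads\<close>

text \<open>Hom-sets are indexed by their end points and need not be disjoint; hence the identity,
  the composition and the arrow part of a functor take the objects involved as arguments.
  \<open>Comp C X Y Z g f\<close> is the composite of \<open>f : X \<rightarrow> Y\<close> and \<open>g : Y \<rightarrow> Z\<close>.\<close>

record ('o, 'm) cat =
  Obj :: "'o set"
  Hom :: "'o \<Rightarrow> 'o \<Rightarrow> 'm set"
  Id :: "'o \<Rightarrow> 'm"
  Comp :: "'o \<Rightarrow> 'o \<Rightarrow> 'o \<Rightarrow> 'm \<Rightarrow> 'm \<Rightarrow> 'm"

definition is_category :: "('o, 'm) cat \<Rightarrow> bool" where
  "is_category C \<longleftrightarrow>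
    (\<forall>X\<in>Obj C. Id C X \<in> Hom C X X) \<and>
    (\<forall>X\<in>Obj C. \<forall>Y\<in>Obj C. \<forall>Z\<in>Obj C. \<forall>f\<in>Hom C X Y. \<forall>g\<in>Hom C Y Z.
      Comp C X Y Z g f \<in> Hom C X Z) \<and>
    (\<forall>X\<in>Obj C. \<forall>Y\<in>Obj C. \<forall>f\<in>Hom C X Y.
      Comp C X X Y f (Id C X) = f \<and> Comp C X Y Y (Id C Y) f = f) \<and>
    (\<forall>W\<in>Obj C. \<forall>X\<in>Obj C. \<forall>Y\<in>Obj C. \<forall>Z\<in>Obj C.
      \<forall>f\<in>Hom C W X. \<forall>g\<in>Hom C X Y. \<forall>h\<in>Hom C Y Z.
      Comp C W X Z (Comp C X Y Z h g) f = Comp C W Y Z h (Comp C W X Y g f))"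

record ('o, 'm, 'p, 'n) ftr =
  FO :: "'o \<Rightarrow> 'p"
  FA :: "'o \<Rightarrow> 'o \<Rightarrow> 'm \<Rightarrow> 'n"

definition is_functor :: "('o, 'm) cat \<Rightarrow> ('p, 'n) cat \<Rightarrow> ('o, 'm, 'p, 'n) ftr \<Rightarrow> bool" where
  "is_functor C D F \<longleftrightarrow> is_category C \<and> is_category D \<and>
    (\<forall>X\<in>Obj C. FO F X \<in> Obj D) \<and>
    (\<forall>X\<in>Obj C. \<forall>Y\<in>Obj C. \<forall>f\<in>Hom C X Y. FA F X Y f \<in> Hom D (FO F X) (FO F Y)) \<and>
    (\<forall>X\<in>Obj C. FA F X X (Id C X) = Id D (FO F X)) \<and>
    (\<forall>X\<in>Obj C. \<forall>Y\<in>Obj C. \<forall>Z\<in>Obj C. \<forall>f\<in>Hom C X Y. \<forall>g\<in>Hom C Y Z.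
      FA F X Z (Comp C X Y Z g f)
        = Comp D (FO F X) (FO F Y) (FO F Z) (FA F Y Z g) (FA F X Y f))"

text \<open>Functors out of \<open>C\<close> are only determined on the objects and arrows of \<open>C\<close>.\<close>

definition functor_eq ::
    "('o, 'm) cat \<Rightarrow> ('o, 'm, 'p, 'n) ftr \<Rightarrow> ('o, 'm, 'p, 'n) ftr \<Rightarrow> bool" where
  "functor_eq C F G \<longleftrightarrow>
    (\<forall>X\<in>Obj C. FO F X = FO G X) \<and>
    (\<forall>X\<in>Obj C. \<forall>Y\<in>Obj C. \<forall>f\<in>Hom C X Y. FA F X Y f = FA G X Y f)"

definition id_functor :: "('o, 'm, 'o, 'm) ftr" where
  "id_functor = \<lparr>FO = (\<lambda>X. X), FA = (\<lambda>X Y f. f)\<rparr>"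

definition comp_functor ::
    "('p, 'n, 'q, 'k) ftr \<Rightarrow> ('o, 'm, 'p, 'n) ftr \<Rightarrow> ('o, 'm, 'q, 'k) ftr" where
  "comp_functor G F =
    \<lparr>FO = (\<lambda>X. FO G (FO F X)), FA = (\<lambda>X Y f. FA G (FO F X) (FO F Y) (FA F X Y f))\<rparr>"

definition is_iso_of_categories ::
    "('o, 'm) cat \<Rightarrow> ('p, 'n) cat \<Rightarrow> ('o, 'm, 'p, 'n) ftr \<Rightarrow> bool" where
  "is_iso_of_categories C D K \<longleftrightarrow> is_functor C D K \<and>
    (\<exists>J. is_functor D C J \<and>
      functor_eq C (comp_functor J K) id_functor \<and>
      functor_eq D (comp_functor K J) id_functor)"

definition is_nat_trans :: "('o, 'm) cat \<Rightarrow> ('p, 'n) cat \<Rightarrow>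
    ('o, 'm, 'p, 'n) ftr \<Rightarrow> ('o, 'm, 'p, 'n) ftr \<Rightarrow> ('o \<Rightarrow> 'n) \<Rightarrow> bool" where
  "is_nat_trans C D F G t \<longleftrightarrow> is_functor C D F \<and> is_functor C D G \<and>
    (\<forall>X\<in>Obj C. t X \<in> Hom D (FO F X) (FO G X)) \<and>
    (\<forall>X\<in>Obj C. \<forall>Y\<in>Obj C. \<forall>f\<in>Hom C X Y.
      Comp D (FO F X) (FO F Y) (FO G Y) (t Y) (FA F X Y f)
        = Comp D (FO F X) (FO G X) (FO G Y) (FA G X Y f) (t X))"

text \<open>\<open>F : C \<rightarrow> D\<close> is left adjoint to \<open>U : D \<rightarrow> C\<close> with unit \<open>\<eta>\<close> and counit \<open>\<epsilon>\<close>.\<close>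

definition is_adjunction :: "('o, 'm) cat \<Rightarrow> ('p, 'n) cat \<Rightarrow>
    ('o, 'm, 'p, 'n) ftr \<Rightarrow> ('p, 'n, 'o, 'm) ftr \<Rightarrow> ('o \<Rightarrow> 'm) \<Rightarrow> ('p \<Rightarrow> 'n) \<Rightarrow> bool" where
  "is_adjunction C D F U \<eta> \<epsilon> \<longleftrightarrow>
    is_functor C D F \<and> is_functor D C U \<and>
    is_nat_trans C C id_functor (comp_functor U F) \<eta> \<and>
    is_nat_trans D D (comp_functor F U) id_functor \<epsilon> \<and>
    (\<forall>X\<in>Obj C.
      Comp D (FO F X) (FO F (FO U (FO F X))) (FO F X)
        (\<epsilon> (FO F X)) (FA F X (FO U (FO F X)) (\<eta> X)) = Id D (FO F X)) \<and>
    (\<forall>Y\<in>Obj D.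
      Comp C (FO U Y) (FO U (FO F (FO U Y))) (FO U Y)
        (FA U (FO F (FO U Y)) Y (\<epsilon> Y)) (\<eta> (FO U Y)) = Id C (FO U Y))"

record ('o, 'm) monad =
  mfun :: "('o, 'm, 'o, 'm) ftr"
  munit :: "'o \<Rightarrow> 'm"
  mmult :: "'o \<Rightarrow> 'm"

definition adj_monad :: "('o, 'm, 'p, 'n) ftr \<Rightarrow> ('p, 'n, 'o, 'm) ftr \<Rightarrow>
    ('o \<Rightarrow> 'm) \<Rightarrow> ('p \<Rightarrow> 'n) \<Rightarrow> ('o, 'm) monad" where
  "adj_monad F U \<eta> \<epsilon> =
    \<lparr>mfun = comp_functor U F,
     munit = \<eta>,
     mmult = (\<lambda>X. FA U (FO F (FO U (FO F X))) (FO F X) (\<epsilon> (FO F X)))\<rparr>"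

definition EM :: "('o, 'm) cat \<Rightarrow> ('o, 'm) monad \<Rightarrow> ('o \<times> 'm, 'm) cat" where
  "EM C T =
    \<lparr>Obj = {(A, \<alpha>). A \<in> Obj C \<and> \<alpha> \<in> Hom C (FO (mfun T) A) A \<and>
        Comp C A (FO (mfun T) A) A \<alpha> (munit T A) = Id C A \<and>
        Comp C (FO (mfun T) (FO (mfun T) A)) (FO (mfun T) A) A \<alpha> (mmult T A)
          = Comp C (FO (mfun T) (FO (mfun T) A)) (FO (mfun T) A) A
              \<alpha> (FA (mfun T) (FO (mfun T) A) A \<alpha>)},
     Hom = (\<lambda>(A, \<alpha>) (B, \<beta>). {h \<in> Hom C A B.
        Comp C (FO (mfun T) A) A B h \<alpha>
          = Comp C (FO (mfun T) A) (FO (mfun T) B) B \<beta> (FA (mfun T) A B h)}),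
     Id = (\<lambda>(A, \<alpha>). Id C A),
     Comp = (\<lambda>(X, \<alpha>) (Y, \<beta>) (Z, \<gamma>) g f. Comp C X Y Z g f)\<rparr>"

definition comparison_functor :: "('o, 'm, 'p, 'n) ftr \<Rightarrow> ('p, 'n, 'o, 'm) ftr \<Rightarrow>
    ('p \<Rightarrow> 'n) \<Rightarrow> ('p, 'n, 'o \<times> 'm, 'm) ftr" where
  "comparison_functor F U \<epsilon> =
    \<lparr>FO = (\<lambda>X. (FO U X, FA U (FO F (FO U X)) X (\<epsilon> X))),
     FA = FA U\<rparr>"

definition strictly_monadic ::
    "('p, 'n) cat \<Rightarrow> ('o, 'm) cat \<Rightarrow> ('p, 'n, 'o, 'm) ftr \<Rightarrow> bool" where
  "strictly_monadic D C U \<longleftrightarrow>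
    (\<exists>F \<eta> \<epsilon>. is_adjunction C D F U \<eta> \<epsilon> \<and>
      is_iso_of_categories D (EM C (adj_monad F U \<eta> \<epsilon>)) (comparison_functor F U \<epsilon>))"


section \<open>Small sets and powers\<close>

text \<open>A type \<open>'a\<close> plays the role of a universe: the sets of the universe are the subsets of
  \<open>'a\<close> of cardinality strictly smaller than that of \<open>'a\<close> itself. If \<open>'a\<close> is a Grothendieck
  universe, these are exactly its elements. Passing from \<open>'a\<close> to \<open>'a list\<close> does not change the
  cardinality bound for infinite \<open>'a\<close>, and makes room for the sets of tuples.
  Arrows are extensional functions (undefined outside the domain), so that
  equality of arrows is equality of functions on the domain; the same convention is used for
  fuzzy relations and for the operations of an algebra.\<close>

definition small :: "'a set \<Rightarrow> bool" where
  "small A \<longleftrightarrow> A \<prec> (UNIV :: 'a set)"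

definition tuples :: "nat \<Rightarrow> 'a set \<Rightarrow> 'a list set" where
  "tuples n A = {xs. length xs = n \<and> set xs \<subseteq> A}"

definition power_functor :: "nat \<Rightarrow> ('a set, 'a \<Rightarrow> 'a, 'a list set, 'a list \<Rightarrow> 'a list) ftr" where
  "power_functor n =
    \<lparr>FO = tuples n, FA = (\<lambda>A B f. \<lambda>xs\<in>tuples n A. map f xs)\<rparr>"


section \<open>Fuzzy relation spaces and generalised metric spaces\<close>

record 'a fspace =
  carr :: "'a set"
  fdist :: "'a \<times> 'a \<Rightarrow> real"

definition nonexpansive :: "'a fspace \<Rightarrow> 'b fspace \<Rightarrow> ('a \<Rightarrow> 'b) \<Rightarrow> bool" where
  "nonexpansive X Y f \<longleftrightarrow>
    (\<forall>a\<in>carr X. \<forall>a'\<in>carr X. fdist Y (f a, f a') \<le> fdist X (a, a'))"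

definition FRel :: "('a fspace, 'a \<Rightarrow> 'a) cat" where
  "FRel =
    \<lparr>Obj = {X. small (carr X) \<and> fdist X \<in> carr X \<times> carr X \<rightarrow>\<^sub>E {0..1}},
     Hom = (\<lambda>X Y. {f \<in> carr X \<rightarrow>\<^sub>E carr Y. nonexpansive X Y f}),
     Id = (\<lambda>X. \<lambda>x\<in>carr X. x),
     Comp = (\<lambda>X Y Z g f. compose (carr X) g f)\<rparr>"

text \<open>The natural numbers serve as the variables of Horn implications.\<close>

datatype atom = EqAtom nat nat | DistAtom nat nat real

datatype horn = Horn "atom list" atom

fun wf_atom :: "atom \<Rightarrow> bool" where
  "wf_atom (EqAtom x y) \<longleftrightarrow> True"
| "wf_atom (DistAtom x y e) \<longleftrightarrow> 0 \<le> e \<and> e \<le> 1"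

fun wf_horn :: "horn \<Rightarrow> bool" where
  "wf_horn (Horn Fs G) \<longleftrightarrow> (\<forall>F\<in>set Fs. wf_atom F) \<and> wf_atom G"

fun sat_atom :: "'a fspace \<Rightarrow> (nat \<Rightarrow> 'a) \<Rightarrow> atom \<Rightarrow> bool" where
  "sat_atom X v (EqAtom x y) \<longleftrightarrow> v x = v y"
| "sat_atom X v (DistAtom x y e) \<longleftrightarrow> fdist X (v x, v y) \<le> e"

fun sat_horn :: "'a fspace \<Rightarrow> horn \<Rightarrow> bool" where
  "sat_horn X (Horn Fs G) \<longleftrightarrow>
    (\<forall>v. range v \<subseteq> carr X \<longrightarrow> (\<forall>F\<in>set Fs. sat_atom X v F) \<longrightarrow> sat_atom X v G)"

definition GMet :: "horn set \<Rightarrow> ('a fspace, 'a \<Rightarrow> 'a) cat" where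
  "GMet H = FRel\<lparr>Obj := {X \<in> Obj FRel. \<forall>\<phi>\<in>H. sat_horn X \<phi>}\<rparr>"

definition forget_GMet_Set :: "('a fspace, 'a \<Rightarrow> 'a, 'a set, 'a \<Rightarrow> 'a) ftr" where
  "forget_GMet_Set = \<lparr>FO = carr, FA = (\<lambda>X Y f. f)\<rparr>"


section \<open>Discrete liftings of finite powers\<close>

definition is_lifting :: "horn set \<Rightarrow> nat \<Rightarrow>
    ('a fspace, 'a \<Rightarrow> 'a, 'a list fspace, 'a list \<Rightarrow> 'a list) ftr \<Rightarrow> bool" where
  "is_lifting H n L \<longleftrightarrow>
    is_functor (GMet H) (GMet H) L \<and>
    functor_eq (GMet H)
      (comp_functor forget_GMet_Set L) (comp_functor (power_functor n) forget_GMet_Set)"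

definition is_discrete_lifting :: "horn set \<Rightarrow> nat \<Rightarrow>
    ('a fspace, 'a \<Rightarrow> 'a, 'a list fspace, 'a list \<Rightarrow> 'a list) ftr \<Rightarrow> bool" where
  "is_discrete_lifting H n L \<longleftrightarrow> is_lifting H n L \<and>
    (\<forall>X\<in>Obj (GMet H). \<forall>Y\<in>Obj (GMet H :: ('a fspace, 'a \<Rightarrow> 'a) cat).
      \<forall>f\<in>tuples n (carr X) \<rightarrow> carr Y. nonexpansive (FO L X) Y f)"

definition has_discrete_finite_products :: "'a itself \<Rightarrow> horn set \<Rightarrow> bool" where
  "has_discrete_finite_products (_ :: 'a itself) H \<longleftrightarrow>
    (\<forall>n. \<exists>L :: ('a fspace, 'a \<Rightarrow> 'a, 'a list fspace, 'a list \<Rightarrow> 'a list) ftr.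
      is_discrete_lifting H n L)"


section \<open>Quantitative algebras\<close>

record ('a, 's) qalg =
  qspace :: "'a fspace"
  opn :: "'s \<Rightarrow> 'a list \<Rightarrow> 'a"

definition QAlg :: "'s set \<Rightarrow> ('s \<Rightarrow> nat) \<Rightarrow> horn set \<Rightarrow> (('a, 's) qalg, 'a \<Rightarrow> 'a) cat" where
  "QAlg \<Sigma> ar H =
    \<lparr>Obj = {X. qspace X \<in> Obj (GMet H) \<and>
        opn X \<in> (\<Pi>\<^sub>E s\<in>\<Sigma>. tuples (ar s) (carr (qspace X)) \<rightarrow>\<^sub>E carr (qspace X))},
     Hom = (\<lambda>X Y. {f \<in> Hom (GMet H) (qspace X) (qspace Y).
        \<forall>s\<in>\<Sigma>. \<forall>xs\<in>tuples (ar s) (carr (qspace X)). f (opn X s xs) = opn Y s (map f xs)}),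
     Id = (\<lambda>X. Id (GMet H) (qspace X)),
     Comp = (\<lambda>X Y Z g f. Comp (GMet H) (qspace X) (qspace Y) (qspace Z) g f)\<rparr>"

definition forget_QAlg_GMet :: "(('a, 's) qalg, 'a \<Rightarrow> 'a, 'a fspace, 'a \<Rightarrow> 'a) ftr" where
  "forget_QAlg_GMet = \<lparr>FO = qspace, FA = (\<lambda>X Y f. f)\<rparr>"

end

theory Submission
  imports Defs
begin

text \<open>The free quantitative algebra on a space \<open>X\<close> consists of the \<open>\<Sigma>\<close>-terms over \<open>X\<close>, where two terms
  are identified if they agree under every nonexpansive interpretation of \<open>X\<close> in a quantitative
  algebra, and where the distance is the supremum of the distances of the interpretations. Horn
  implications pass to such suprema, because each atomic formula holds for the terms iff it holds
  under all interpretations. An Eilenberg-Moore algebra \<open>\<alpha>\<close> on \<open>A\<close> carries the operations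
  \<open>s xs = \<alpha> (s (map \<eta> xs))\<close>; associativity of \<open>\<alpha>\<close> makes it a homomorphism from the free algebra, hence
  the component of the counit at this quantitative algebra.\<close>

section \<open>Universal arrows and the comparison functor\<close>

lemma category_Id: "is_category C \<Longrightarrow> X \<in> Obj C \<Longrightarrow> Id C X \<in> Hom C X X"
  by (simp add: is_category_def)

lemma category_Comp:
  "is_category C \<Longrightarrow> X \<in> Obj C \<Longrightarrow> Y \<in> Obj C \<Longrightarrow> Z \<in> Obj C \<Longrightarrow> f \<in> Hom C X Y \<Longrightarrow> g \<in> Hom C Y Z
    \<Longrightarrow> Comp C X Y Z g f \<in> Hom C X Z"
  by (simp add: is_category_def)

lemma category_Id_right:
  "is_category C \<Longrightarrow> X \<in> Obj C \<Longrightarrow> Y \<in> Obj C \<Longrightarrow> f \<in> Hom C X Y \<Longrightarrow> Comp C X X Y f (Id C X) = f"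
  by (simp add: is_category_def)

lemma category_Id_left:
  "is_category C \<Longrightarrow> X \<in> Obj C \<Longrightarrow> Y \<in> Obj C \<Longrightarrow> f \<in> Hom C X Y \<Longrightarrow> Comp C X Y Y (Id C Y) f = f"
  by (simp add: is_category_def)

lemma category_assoc:
  "is_category C \<Longrightarrow> W \<in> Obj C \<Longrightarrow> X \<in> Obj C \<Longrightarrow> Y \<in> Obj C \<Longrightarrow> Z \<in> Obj C
    \<Longrightarrow> f \<in> Hom C W X \<Longrightarrow> g \<in> Hom C X Y \<Longrightarrow> h \<in> Hom C Y Z
    \<Longrightarrow> Comp C W X Z (Comp C X Y Z h g) f = Comp C W Y Z h (Comp C W X Y g f)"
  by (simp add: is_category_def)

lemma functor_dom: "is_functor C D F \<Longrightarrow> is_category C"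
  by (simp add: is_functor_def)

lemma functor_cod: "is_functor C D F \<Longrightarrow> is_category D"
  by (simp add: is_functor_def)

lemma functor_Obj: "is_functor C D F \<Longrightarrow> X \<in> Obj C \<Longrightarrow> FO F X \<in> Obj D"
  by (simp add: is_functor_def)

lemma functor_Hom:
  "is_functor C D F \<Longrightarrow> X \<in> Obj C \<Longrightarrow> Y \<in> Obj C \<Longrightarrow> f \<in> Hom C X Y
    \<Longrightarrow> FA F X Y f \<in> Hom D (FO F X) (FO F Y)"
  by (simp add: is_functor_def)

lemma functor_Id: "is_functor C D F \<Longrightarrow> X \<in> Obj C \<Longrightarrow> FA F X X (Id C X) = Id D (FO F X)"
  by (simp add: is_functor_def)

lemma functor_Comp:
  "is_functor C D F \<Longrightarrow> X \<in> Obj C \<Longrightarrow> Y \<in> Obj C \<Longrightarrow> Z \<in> Obj C \<Longrightarrow> f \<in> Hom C X Y \<Longrightarrow> g \<in> Hom C Y Z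
    \<Longrightarrow> FA F X Z (Comp C X Y Z g f)
      = Comp D (FO F X) (FO F Y) (FO F Z) (FA F Y Z g) (FA F X Y f)"
  by (simp add: is_functor_def)

lemma is_functor_id_functor: "is_category C \<Longrightarrow> is_functor C C id_functor"
  by (simp add: is_functor_def id_functor_def category_Id)

lemma is_functor_comp_functor:
  "is_functor C D F \<Longrightarrow> is_functor D E G \<Longrightarrow> is_functor C E (comp_functor G F)"
  unfolding is_functor_def comp_functor_def by simp

text \<open>The inverse maps form a functor because injectivity of \<open>K\<close> on each hom-set
  reflects identities and composites. Hom-sets are indexed by their end points, so the arrow part is
  inverted separately on each of them.\<close>

lemma is_iso_of_categories_if_bij_betw:
  assumes K: "is_functor C D K"
    and obj: "bij_betw (FO K) (Obj C) (Obj D)"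
    and hom: "\<And>X Y. X \<in> Obj C \<Longrightarrow> Y \<in> Obj C
      \<Longrightarrow> bij_betw (FA K X Y) (Hom C X Y) (Hom D (FO K X) (FO K Y))"
  shows "is_iso_of_categories C D K"
proof -
  define o' where "o' = inv_into (Obj C) (FO K)"
  define a' where "a' P Q = inv_into (Hom C (o' P) (o' Q)) (FA K (o' P) (o' Q))" for P Q
  define J where "J = \<lparr>FO = o', FA = a'\<rparr>"
  have o1: "o' P \<in> Obj C" "FO K (o' P) = P" if "P \<in> Obj D" for P
    using that obj unfolding o'_def
    by (auto simp: bij_betw_def inv_into_into f_inv_into_f)
  have o2: "o' (FO K X) = X" if "X \<in> Obj C" for X
    using that obj unfolding o'_def by (simp add: bij_betw_def)
  have a1: "a' P Q h \<in> Hom C (o' P) (o' Q)" "FA K (o' P) (o' Q) (a' P Q h) = h"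
    if "P \<in> Obj D" "Q \<in> Obj D" "h \<in> Hom D P Q" for P Q h
  proof -
    have "h \<in> FA K (o' P) (o' Q) ` Hom C (o' P) (o' Q)"
      using hom[of "o' P" "o' Q"] o1 that by (simp add: bij_betw_def)
    then show "a' P Q h \<in> Hom C (o' P) (o' Q)" "FA K (o' P) (o' Q) (a' P Q h) = h"
      unfolding a'_def by (auto simp: inv_into_into f_inv_into_f)
  qed
  \<comment> \<open>The equations on arrows required of \<open>J\<close> are all of this form: it
    suffices that the candidate \<open>k\<close> lies in the right hom-set and is sent to
    \<open>h\<close> by \<open>K\<close>.\<close>
  have a2: "a' P Q h = k"
    if "P \<in> Obj D" "Q \<in> Obj D" "k \<in> Hom C (o' P) (o' Q)" "FA K (o' P) (o' Q) k = h" for P Q h k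
    using hom[of "o' P" "o' Q"] o1 that unfolding a'_def by (auto simp: bij_betw_def)
  note C = functor_dom[OF K] and D = functor_cod[OF K]
  have "is_functor D C J"
    unfolding is_functor_def J_def
    using C D o1 a1
    by (auto intro!: a2 category_Id category_Comp simp: functor_Id[OF K] functor_Comp[OF K])
  moreover have "functor_eq C (comp_functor J K) id_functor"
    unfolding functor_eq_def comp_functor_def id_functor_def J_def
    using o2 by (auto intro!: a2 functor_Obj[OF K])
  moreover have "functor_eq D (comp_functor K J) id_functor"
    unfolding functor_eq_def comp_functor_def id_functor_def J_def
    using o1 a1 by auto
  ultimately show ?thesis
    using K unfolding is_iso_of_categories_def by blast
qed

text \<open>An adjunction presented by universal arrows from the objects of \<open>C\<close> to
  \<open>U\<close>, so that only the object part of the left adjoint has to be supplied.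
  \<open>lift_unique\<close> expresses uniqueness of factorisations equationally: every
  \<open>g\<close> is the lift of its own restriction along the unit.\<close>

locale universal_arrows =
  fixes C :: "('o, 'm) cat" and D :: "('p, 'n) cat" and U :: "('p, 'n, 'o, 'm) ftr"
    and F0 :: "'o \<Rightarrow> 'p" and \<eta> :: "'o \<Rightarrow> 'm" and lift :: "'o \<Rightarrow> 'p \<Rightarrow> 'm \<Rightarrow> 'n"
  assumes functor_U: "is_functor D C U"
    and F0: "\<And>X. X \<in> Obj C \<Longrightarrow> F0 X \<in> Obj D"
    and eta: "\<And>X. X \<in> Obj C \<Longrightarrow> \<eta> X \<in> Hom C X (FO U (F0 X))"
    and lift: "\<And>X Y f. X \<in> Obj C \<Longrightarrow> Y \<in> Obj D \<Longrightarrow> f \<in> Hom C X (FO U Y) \<Longrightarrow> lift X Y f \<in> Hom D (F0 X) Y"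
    and lift_eta: "\<And>X Y f. X \<in> Obj C \<Longrightarrow> Y \<in> Obj D \<Longrightarrow> f \<in> Hom C X (FO U Y)
      \<Longrightarrow> Comp C X (FO U (F0 X)) (FO U Y) (FA U (F0 X) Y (lift X Y f)) (\<eta> X) = f"
    and lift_unique: "\<And>X Y g. X \<in> Obj C \<Longrightarrow> Y \<in> Obj D \<Longrightarrow> g \<in> Hom D (F0 X) Y
      \<Longrightarrow> lift X Y (Comp C X (FO U (F0 X)) (FO U Y) (FA U (F0 X) Y g) (\<eta> X)) = g"
begin

definition left_adjoint :: "('o, 'm, 'p, 'n) ftr" where
  "left_adjoint = \<lparr>FO = F0, FA = (\<lambda>X Y f. lift X (F0 Y) (Comp C X Y (FO U (F0 Y)) (\<eta> Y) f))\<rparr>"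

definition counit :: "'p \<Rightarrow> 'n" where
  "counit Y = lift (FO U Y) Y (Id C (FO U Y))"

lemma category_C: "is_category C" and category_D: "is_category D"
  using functor_U by (simp_all add: functor_dom functor_cod)

lemmas C_rules = category_Id[OF category_C] category_Comp[OF category_C]
  category_Id[OF category_D] category_Comp[OF category_D]
  functor_Obj[OF functor_U] functor_Hom[OF functor_U]

text \<open>Both arrows are lifts of the same restriction along \<eta>. Equations between arrows out
  of a free object are thus checked on generators only.\<close>

lemma lift_eqI:
  assumes "X \<in> Obj C" "Y \<in> Obj D" "g \<in> Hom D (F0 X) Y" "h \<in> Hom D (F0 X) Y"
    and "Comp C X (FO U (F0 X)) (FO U Y) (FA U (F0 X) Y g) (\<eta> X)
      = Comp C X (FO U (F0 X)) (FO U Y) (FA U (F0 X) Y h) (\<eta> X)"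
  shows "g = h"
  using assms lift_unique by metis

lemma FO_left_adjoint [simp]: "FO left_adjoint = F0"
  by (simp add: left_adjoint_def)

lemma FA_left_adjoint:
  assumes "X \<in> Obj C" "Y \<in> Obj C" "f \<in> Hom C X Y"
  shows FA_left_adjoint_in_Hom: "FA left_adjoint X Y f \<in> Hom D (F0 X) (F0 Y)"
    and FA_left_adjoint_eta: "Comp C X (FO U (F0 X)) (FO U (F0 Y)) (FA U (F0 X) (F0 Y) (FA left_adjoint X Y f)) (\<eta> X)
      = Comp C X Y (FO U (F0 Y)) (\<eta> Y) f"
  using assms by (auto simp: left_adjoint_def intro!: lift lift_eta C_rules F0 eta)

lemma counit:
  assumes "Y \<in> Obj D"
  shows counit_in_Hom: "counit Y \<in> Hom D (F0 (FO U Y)) Y"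
    and counit_eta: "Comp C (FO U Y) (FO U (F0 (FO U Y))) (FO U Y)
      (FA U (F0 (FO U Y)) Y (counit Y)) (\<eta> (FO U Y)) = Id C (FO U Y)"
  using assms by (auto simp: counit_def intro!: lift lift_eta C_rules)

text \<open>This follows from functoriality of \<open>U\<close>, associativity and naturality of
  \<eta>. As a rewrite rule it eliminates \<open>FA left_adjoint\<close> and so reduces the functor
  laws, naturality and a triangle identity to computations in \<open>C\<close>.\<close>

lemma Comp_FA_left_adjoint_eta:
  assumes "X \<in> Obj C" "Y \<in> Obj C" "Z \<in> Obj D" "f \<in> Hom C X Y" "g \<in> Hom D (F0 Y) Z"
  shows "Comp C X (FO U (F0 X)) (FO U Z)
      (FA U (F0 X) Z (Comp D (F0 X) (F0 Y) Z g (FA left_adjoint X Y f))) (\<eta> X)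
    = Comp C X Y (FO U Z) (Comp C Y (FO U (F0 Y)) (FO U Z) (FA U (F0 Y) Z g) (\<eta> Y)) f"
proof -
  note [simp] = assms F0 eta FA_left_adjoint C_rules
  show ?thesis
    by (simp add: functor_Comp[OF functor_U] category_assoc[OF category_C])
qed

lemma Comp_eta:
  assumes "X \<in> Obj C" "Y \<in> Obj D" "Z \<in> Obj D" "f \<in> Hom D (F0 X) Y" "g \<in> Hom D Y Z"
  shows "Comp C X (FO U (F0 X)) (FO U Z) (FA U (F0 X) Z (Comp D (F0 X) Y Z g f)) (\<eta> X)
    = Comp C X (FO U Y) (FO U Z) (FA U Y Z g)
        (Comp C X (FO U (F0 X)) (FO U Y) (FA U (F0 X) Y f) (\<eta> X))"
proof -
  note [simp] = assms F0 eta C_rules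
  show ?thesis
    by (simp add: functor_Comp[OF functor_U] category_assoc[OF category_C])
qed

lemma functor_left_adjoint: "is_functor C D left_adjoint"
proof -
  have "FA left_adjoint X X (Id C X) = Id D (F0 X)" if X: "X \<in> Obj C" for X
  proof (rule lift_eqI[of X "F0 X"])
  qed (use X in \<open>simp_all add: F0 eta FA_left_adjoint C_rules functor_Id[OF functor_U]
        category_Id_left[OF category_C] category_Id_right[OF category_C]\<close>)
  moreover have "FA left_adjoint X Z (Comp C X Y Z g f)
      = Comp D (F0 X) (F0 Y) (F0 Z) (FA left_adjoint Y Z g) (FA left_adjoint X Y f)"
    if "X \<in> Obj C" "Y \<in> Obj C" "Z \<in> Obj C" "f \<in> Hom C X Y" "g \<in> Hom C Y Z" for X Y Z f g
  proof (rule lift_eqI[of X "F0 Z"])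
  qed (use that in \<open>simp_all add: F0 eta FA_left_adjoint C_rules Comp_FA_left_adjoint_eta
        category_assoc[OF category_C]\<close>)
  ultimately show ?thesis
    by (simp add: is_functor_def category_C category_D F0 FA_left_adjoint)
qed

lemma adjunction: "is_adjunction C D left_adjoint U \<eta> counit"
proof -
  note [simp] = F0 eta FA_left_adjoint C_rules counit Comp_FA_left_adjoint_eta
    category_Id_left[OF category_C] category_Id_right[OF category_C]
  have "is_nat_trans C C id_functor (comp_functor U left_adjoint) \<eta>"
    unfolding is_nat_trans_def
    using is_functor_comp_functor[OF functor_left_adjoint functor_U] is_functor_id_functor[OF category_C]
    by (auto simp: comp_functor_def id_functor_def)
  moreover have "Comp D (F0 (FO U X)) (F0 (FO U Y)) Y (counit Y)
        (FA left_adjoint (FO U X) (FO U Y) (FA U X Y f))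
      = Comp D (F0 (FO U X)) X Y f (counit X)"
    if "X \<in> Obj D" "Y \<in> Obj D" "f \<in> Hom D X Y" for X Y f
  proof (rule lift_eqI[of "FO U X" Y])
    show "Comp C (FO U X) (FO U (F0 (FO U X))) (FO U Y)
        (FA U (F0 (FO U X)) Y (Comp D (F0 (FO U X)) (F0 (FO U Y)) Y (counit Y)
          (FA left_adjoint (FO U X) (FO U Y) (FA U X Y f)))) (\<eta> (FO U X))
      = Comp C (FO U X) (FO U (F0 (FO U X))) (FO U Y)
        (FA U (F0 (FO U X)) Y (Comp D (F0 (FO U X)) X Y f (counit X))) (\<eta> (FO U X))"
      \<comment> \<open>The instance confines \<open>Comp_eta\<close> to the right-hand side; the
        left-hand side is handled by \<open>Comp_FA_left_adjoint_eta\<close>. Both sides reduce to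
        \<open>FA U X Y f\<close>.\<close>
      using that by (simp add: Comp_eta[where f = "counit X"])
  qed (use that in simp_all)
  then have "is_nat_trans D D (comp_functor left_adjoint U) id_functor counit"
    unfolding is_nat_trans_def
    using is_functor_comp_functor[OF functor_U functor_left_adjoint] is_functor_id_functor[OF category_D]
    by (auto simp: comp_functor_def id_functor_def)
  moreover have "Comp D (F0 X) (F0 (FO U (F0 X))) (F0 X) (counit (F0 X))
      (FA left_adjoint X (FO U (F0 X)) (\<eta> X)) = Id D (F0 X)" if "X \<in> Obj C" for X
    by (rule lift_eqI[of X "F0 X"]) (use that in \<open>simp_all add: functor_Id[OF functor_U]\<close>)
  ultimately show ?thesis
    using functor_U functor_left_adjoint by (simp add: is_adjunction_def)
qed

end

section \<open>Eilenberg-Moore categories and the comparison functor\<close>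

lemma category_EM:
  assumes C: "is_category C" and T: "is_functor C C (mfun T)"
  shows "is_category (EM C T)"
proof -
  note [simp] = category_Id[OF C] category_Comp[OF C] functor_Obj[OF T] functor_Hom[OF T]
    category_Id_left[OF C] category_Id_right[OF C] functor_Id[OF T] functor_Comp[OF T]
  have "Comp C (FO (mfun T) X) X Z (Comp C X Y Z g f) \<alpha>
      = Comp C (FO (mfun T) X) (FO (mfun T) Z) Z \<gamma> (FA (mfun T) X Z (Comp C X Y Z g f))"
    if *: "X \<in> Obj C" "Y \<in> Obj C" "Z \<in> Obj C"
      "\<alpha> \<in> Hom C (FO (mfun T) X) X" "\<beta> \<in> Hom C (FO (mfun T) Y) Y" "\<gamma> \<in> Hom C (FO (mfun T) Z) Z"
      "f \<in> Hom C X Y" "g \<in> Hom C Y Z"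
      "Comp C (FO (mfun T) X) X Y f \<alpha> = Comp C (FO (mfun T) X) (FO (mfun T) Y) Y \<beta> (FA (mfun T) X Y f)"
      "Comp C (FO (mfun T) Y) Y Z g \<beta> = Comp C (FO (mfun T) Y) (FO (mfun T) Z) Z \<gamma> (FA (mfun T) Y Z g)"
    for X Y Z \<alpha> \<beta> \<gamma> f g
  proof -
    let ?T = "FO (mfun T)"
    \<comment> \<open>The homomorphism squares of \<open>f\<close> and \<open>g\<close> are pasted
      along \<beta>.\<close>
    have "Comp C (?T X) X Z (Comp C X Y Z g f) \<alpha> = Comp C (?T X) Y Z g (Comp C (?T X) X Y f \<alpha>)"
      by (rule category_assoc[OF C]) (use * in simp_all)
    also have "\<dots> = Comp C (?T X) (?T Y) Z (Comp C (?T Y) Y Z g \<beta>) (FA (mfun T) X Y f)"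
      unfolding *(9) by (rule category_assoc[OF C, symmetric]) (use * in simp_all)
    also have "\<dots> = Comp C (?T X) (?T Z) Z \<gamma> (FA (mfun T) X Z (Comp C X Y Z g f))"
      unfolding *(10) by (subst category_assoc[OF C]) (use * in simp_all)
    finally show ?thesis .
  qed
  then show ?thesis
    unfolding is_category_def EM_def
    by (auto simp: category_assoc[OF C])
qed

text \<open>On objects, the unit law is a triangle identity and the associativity law is naturality
  of \<epsilon> at the arrow \<open>\<epsilon> Y\<close> itself. On arrows, naturality at
  \<open>f\<close> is the homomorphism square.\<close>

lemma functor_comparison_functor:
  assumes "is_adjunction C D F U \<eta> \<epsilon>"
  shows "is_functor D (EM C (adj_monad F U \<eta> \<epsilon>)) (comparison_functor F U \<epsilon>)"
proof -
  have F: "is_functor C D F" and U: "is_functor D C U"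
    and \<epsilon>: "is_nat_trans D D (comp_functor F U) id_functor \<epsilon>"
    and triangle: "\<And>Y. Y \<in> Obj D \<Longrightarrow>
      Comp C (FO U Y) (FO U (FO F (FO U Y))) (FO U Y)
        (FA U (FO F (FO U Y)) Y (\<epsilon> Y)) (\<eta> (FO U Y)) = Id C (FO U Y)"
    using assms by (simp_all add: is_adjunction_def)
  note [simp] = functor_Obj[OF F] functor_Hom[OF F] functor_Obj[OF U] functor_Hom[OF U]
  have \<epsilon>_Hom [simp]: "\<epsilon> Y \<in> Hom D (FO F (FO U Y)) Y" if "Y \<in> Obj D" for Y
    using \<epsilon> that by (simp add: is_nat_trans_def comp_functor_def id_functor_def)
  have nat: "Comp C (FO U (FO F (FO U X))) (FO U X) (FO U Y) (FA U X Y f) (FA U (FO F (FO U X)) X (\<epsilon> X))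
      = Comp C (FO U (FO F (FO U X))) (FO U (FO F (FO U Y))) (FO U Y) (FA U (FO F (FO U Y)) Y (\<epsilon> Y))
        (FA U (FO F (FO U X)) (FO F (FO U Y)) (FA F (FO U X) (FO U Y) (FA U X Y f)))"
    if "X \<in> Obj D" "Y \<in> Obj D" "f \<in> Hom D X Y" for X Y f
  proof -
    have "Comp D (FO F (FO U X)) (FO F (FO U Y)) Y (\<epsilon> Y) (FA F (FO U X) (FO U Y) (FA U X Y f))
        = Comp D (FO F (FO U X)) X Y f (\<epsilon> X)"
      using \<epsilon> that by (simp add: is_nat_trans_def comp_functor_def id_functor_def)
    with that show ?thesis
      by (simp flip: functor_Comp[OF U])
  qed
  have "is_category (EM C (adj_monad F U \<eta> \<epsilon>))"
    by (rule category_EM)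
      (simp_all add: adj_monad_def is_functor_comp_functor[OF F U] functor_dom[OF F])
  then show ?thesis
    unfolding is_functor_def
    using functor_dom[OF U] nat triangle
    by (auto simp: comparison_functor_def EM_def adj_monad_def comp_functor_def
        functor_Id[OF U] functor_Comp[OF U])
qed

section \<open>Sets of terms are small\<close>

unbundle cardinal_syntax

text \<open>A pairing injection \<open>p\<close> on the infinite set \<open>K\<close> codes lists by
  iteration. The distinct elements \<open>a\<close> and \<open>b\<close> of \<open>K\<close> serve
  as tags in the first component, which separate the empty list from nonempty ones.\<close>

lemma infinite_lists_lepoll:
  assumes "infinite K"
  shows "lists K \<lesssim> K"
proof -
  obtain p where "bij_betw p (K \<times> K) K"
    using card_of_Times_same_infinite[OF assms] unfolding card_of_ordIso[symmetric] ..
  then have p: "inj_on p (K \<times> K)" "p ` (K \<times> K) \<subseteq> K"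
    by (simp_all add: bij_betw_def)
  obtain a where a: "a \<in> K" using assms by fastforce
  have "K - {a} \<noteq> {}" using assms by (metis finite.emptyI infinite_remove)
  then obtain b where b: "b \<in> K" "b \<noteq> a" by blast
  have p_in: "p (x, y) \<in> K" if "x \<in> K" "y \<in> K" for x y
    using p that by blast
  have p_eq: "p (x, y) = p (x', y') \<longleftrightarrow> x = x' \<and> y = y'"
    if "x \<in> K" "y \<in> K" "x' \<in> K" "y' \<in> K" for x y x' y'
    using p(1) that by (auto simp: inj_on_def)
  define l where "l xs = foldr (\<lambda>x c. p (b, p (x, c))) xs (p (a, a))" for xs
  have l_simps: "l [] = p (a, a)" "l (x # xs) = p (b, p (x, l xs))" for x xs
    by (simp_all add: l_def)
  have l_in: "l xs \<in> K" if "xs \<in> lists K" for xs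
    using that by induction (simp_all add: l_simps p_in a b)
  have l_Nil_neq: "l [] \<noteq> l (x # xs)" if "x \<in> K" "xs \<in> lists K" for x xs
    unfolding l_simps by (subst p_eq) (use that a b l_in p_in in auto)
  have l_Cons_eq: "x = y \<and> l xs = l ys"
    if "l (x # xs) = l (y # ys)" "x \<in> K" "xs \<in> lists K" "y \<in> K" "ys \<in> lists K" for x y xs ys
  proof -
    have "p (x, l xs) = p (y, l ys)"
      using that(1) unfolding l_simps by (subst (asm) p_eq) (use that(2-) b l_in p_in in auto)
    then show ?thesis
      by (subst (asm) p_eq) (use that(2-) l_in in auto)
  qed
  have "\<forall>ys\<in>lists K. l xs = l ys \<longrightarrow> xs = ys" if "xs \<in> lists K" for xs
    using that
  proof induction
    case Nil
    show ?case
    proof (intro ballI impI)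
      fix ys assume ys: "ys \<in> lists K" "l [] = l ys"
      show "[] = ys"
        using ys(1) by cases (use ys(2) l_Nil_neq in auto)
    qed
  next
    case (Cons x xs)
    show ?case
    proof (intro ballI impI)
      fix ys assume ys: "ys \<in> lists K" "l (x # xs) = l ys"
      from ys(1) show "x # xs = ys"
      proof cases
        case Nil
        then show ?thesis using ys(2) l_Nil_neq Cons.hyps by metis
      next
        case (Cons y ys')
        with ys(2) \<open>x \<in> K\<close> \<open>xs \<in> lists K\<close> have "x = y \<and> l xs = l ys'"
          by (intro l_Cons_eq) simp_all
        with Cons Cons.IH show ?thesis by blast
      qed
    qed
  qed
  with l_in show ?thesis
    unfolding lepoll_def by (intro exI[of _ l]) (auto simp: inj_on_def)
qed

section \<open>Terms and their cardinality\<close>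

datatype ('v, 's) tm = Var 'v | Op 's "('v, 's) tm list"

inductive_set terms :: "'s set \<Rightarrow> ('s \<Rightarrow> nat) \<Rightarrow> 'v set \<Rightarrow> ('v, 's) tm set"
  for \<Sigma> ar V where
  Var: "x \<in> V \<Longrightarrow> Var x \<in> terms \<Sigma> ar V"
| Op: "s \<in> \<Sigma> \<Longrightarrow> length ts = ar s \<Longrightarrow> (\<forall>t\<in>set ts. t \<in> terms \<Sigma> ar V) \<Longrightarrow> Op s ts \<in> terms \<Sigma> ar V"

text \<open>One recursor for two purposes: the interpretation of terms in an algebra, and the coding
  of terms in \<open>terms_lepoll\<close>.\<close>

primrec eval :: "('v \<Rightarrow> 'a) \<Rightarrow> ('s \<Rightarrow> 'a list \<Rightarrow> 'a) \<Rightarrow> ('v, 's) tm \<Rightarrow> 'a" where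
  "eval v f (Var x) = v x"
| "eval v f (Op s ts) = f s (map (eval v f) ts)"

text \<open>A term is coded recursively by an element of \<open>K\<close>: a variable through the
  left summand of \<open>K <+> (K \<times> K)\<close>, an operation through the right one, as the
  pair of its symbol and the coded list of the codes of its arguments.\<close>

lemma terms_lepoll:
  assumes K: "infinite K" and V: "V \<lesssim> K" and \<Sigma>: "\<Sigma> \<lesssim> K"
  shows "terms \<Sigma> ar V \<lesssim> K"
proof -
  have "K <+> (K \<times> K) \<lesssim> K"
  proof -
    have "|K \<times> K| \<le>o |K|"
      by (rule ordIso_imp_ordLeq[OF card_of_Times_same_infinite[OF K]])
    then have "|K <+> (K \<times> K)| \<le>o |K|"
      by (rule ordIso_imp_ordLeq[OF card_of_Plus_infinite1[OF K]])
    then show ?thesis by (simp add: lepoll_def card_of_ordLeq)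
  qed
  then obtain p where p: "inj_on p (K <+> (K \<times> K))" "p ` (K <+> (K \<times> K)) \<subseteq> K"
    unfolding lepoll_def by blast
  obtain l where l: "inj_on l (lists K)" "l ` lists K \<subseteq> K"
    using infinite_lists_lepoll[OF K] unfolding lepoll_def by blast
  obtain i where i: "inj_on i V" "i ` V \<subseteq> K" using V unfolding lepoll_def by blast
  obtain j where j: "inj_on j \<Sigma>" "j ` \<Sigma> \<subseteq> K" using \<Sigma> unfolding lepoll_def by blast
  define e where "e = eval (\<lambda>x. p (Inl (i x))) (\<lambda>s ks. p (Inr (j s, l ks)))"
  have e_simps: "e (Var x) = p (Inl (i x))" "e (Op s ts) = p (Inr (j s, l (map e ts)))" for x s ts
    by (simp_all add: e_def)
  have e_in: "e t \<in> K" if "t \<in> terms \<Sigma> ar V" for t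
    using that
  proof induction
    case (Var x)
    with i have "Inl (i x) \<in> K <+> (K \<times> K)" by auto
    with p show ?case by (auto simp: e_simps)
  next
    case (Op s ts)
    then have "map e ts \<in> lists K" by auto
    with Op j l have "Inr (j s, l (map e ts)) \<in> K <+> (K \<times> K)" by auto
    with p show ?case by (auto simp: e_simps)
  qed
  have p_eq: "x = y" if "p x = p y" "x \<in> K <+> (K \<times> K)" "y \<in> K <+> (K \<times> K)" for x y
    using p(1) that by (auto dest: inj_onD)
  have var: "Inl (i x) \<in> K <+> (K \<times> K)" if "x \<in> V" for x
    using i that by auto
  have op: "Inr (j s, l (map e ts)) \<in> K <+> (K \<times> K)" "map e ts \<in> lists K"
    if "s \<in> \<Sigma>" "\<forall>t\<in>set ts. t \<in> terms \<Sigma> ar V" for s ts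
  proof -
    show "map e ts \<in> lists K" using that e_in by auto
    with l j that show "Inr (j s, l (map e ts)) \<in> K <+> (K \<times> K)" by auto
  qed
  have "\<forall>t'\<in>terms \<Sigma> ar V. e t = e t' \<longrightarrow> t = t'" if "t \<in> terms \<Sigma> ar V" for t
    using that
  proof induction
    case (Var x)
    show ?case
    proof (intro ballI impI)
      fix t' assume t': "t' \<in> terms \<Sigma> ar V" "e (Var x) = e t'"
      from t' show "Var x = t'"
      proof cases
        case (Var y)
        then show ?thesis
          using p_eq[OF _ var var] t' \<open>x \<in> V\<close> i(1) by (auto simp: e_simps dest: inj_onD)
      next
        case (Op s ts)
        then show ?thesis
          using p_eq[OF _ var op(1)] t' \<open>x \<in> V\<close> by (auto simp: e_simps)
      qed
    qed
  next
    case (Op s ts)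
    show ?case
    proof (intro ballI impI)
      fix t' assume t': "t' \<in> terms \<Sigma> ar V" "e (Op s ts) = e t'"
      from t' show "Op s ts = t'"
      proof cases
        case (Var y)
        then show ?thesis
          using p_eq[OF _ op(1) var] t' Op by (auto simp: e_simps)
      next
        case o: (Op s' ts')
        have ts: "\<forall>t\<in>set ts. t \<in> terms \<Sigma> ar V" using Op by auto
        have "j s = j s'" "l (map e ts) = l (map e ts')"
          using p_eq[OF _ op(1) op(1)] t' Op(1) o ts by (auto simp: e_simps)
        then have "s = s'" "map e ts = map e ts'"
          using inj_onD[OF j(1)] inj_onD[OF l(1) _ op(2) op(2)] Op(1) o ts by auto
        moreover have "ts = ts'"
          \<comment> \<open>Injectivity of \<open>e\<close> is so far known only at the arguments in
            \<open>ts\<close>, by the induction hypothesis; this is enough to cancel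
            \<open>map e\<close>.\<close>
          by (rule list.inj_map_strong[OF _ \<open>map e ts = map e ts'\<close>]) (use Op.IH o in blast)
        ultimately show ?thesis using o by simp
      qed
    qed
  qed
  with e_in show ?thesis
    unfolding lepoll_def by (intro exI[of _ e]) (auto simp: inj_on_def)
qed

text \<open>The bridge to cardinal orders, where sums of two smaller cardinals are known to stay
  below an infinite one.\<close>

lemma lesspoll_iff_ordLess: "A \<prec> B \<longleftrightarrow> |A| <o |B|"
  unfolding lesspoll_def lepoll_def card_of_ordLeq eqpoll_iff_card_of_ordIso
  using ordLeq_iff_ordLess_or_ordIso not_ordLess_ordIso by blast

lemma Plus_lesspoll:
  assumes "infinite C" "A \<prec> C" "B \<prec> C"
  shows "A <+> B \<prec> C"
  using assms card_of_Plus_ordLess_infinite by (auto simp: lesspoll_iff_ordLess)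

text \<open>The terms embed into the sum of \<open>V\<close>, \<Sigma> and the natural numbers.
  Uncountability of \<open>U\<close> puts the natural numbers strictly below it; over a countable
  \<open>U\<close>, finitely many variables and symbols could already yield as many terms as
  \<open>U\<close> has elements.\<close>

lemma terms_lesspoll:
  assumes "uncountable U" "V \<prec> U" "\<Sigma> \<prec> U"
  shows "terms \<Sigma> ar V \<prec> U"
proof -
  let ?K = "V <+> \<Sigma> <+> (UNIV :: nat set)"
  have U: "infinite U" using assms(1) countable_finite by blast
  have "\<not> U \<lesssim> (UNIV :: nat set)"
    using assms(1) countable_lepoll[of "UNIV :: nat set" U] by auto
  then have "\<not> (UNIV :: nat set) \<approx> U"
    using eqpoll_imp_lepoll[OF eqpoll_sym] by auto
  then have "(UNIV :: nat set) \<prec> U"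
    using U by (simp add: lesspoll_def infinite_le_lepoll)
  then have "?K \<prec> U" using assms U by (intro Plus_lesspoll)
  moreover have "terms \<Sigma> ar V \<lesssim> ?K"
  proof (rule terms_lepoll)
    show "infinite ?K" by (simp add: finite_Plus_iff)
    show "V \<lesssim> ?K" unfolding lepoll_def by (intro exI[of _ Inl]) auto
    show "\<Sigma> \<lesssim> ?K" unfolding lepoll_def by (intro exI[of _ "\<lambda>s. Inr (Inl s)"]) (auto simp: inj_on_def)
  qed
  ultimately show ?thesis by (rule lesspoll_trans1[rotated])
qed

unbundle no cardinal_syntax

section \<open>Generalised metric spaces and quantitative algebras\<close>

lemma Hom_GMet: "Hom (GMet H) X Y = {f \<in> carr X \<rightarrow>\<^sub>E carr Y. nonexpansive X Y f}"
  by (simp add: GMet_def FRel_def)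

lemma Id_GMet: "Id (GMet H) X = (\<lambda>x\<in>carr X. x)"
  by (simp add: GMet_def FRel_def)

lemma Comp_GMet: "Comp (GMet H) X Y Z g f = compose (carr X) g f"
  by (simp add: GMet_def FRel_def)

lemma Obj_GMet:
  "X \<in> Obj (GMet H) \<longleftrightarrow> small (carr X) \<and> fdist X \<in> carr X \<times> carr X \<rightarrow>\<^sub>E {0..1} \<and> (\<forall>\<phi>\<in>H. sat_horn X \<phi>)"
  by (auto simp: GMet_def FRel_def)

lemma Obj_GMet_fdist:
  assumes "X \<in> Obj (GMet H)" "x \<in> carr X" "y \<in> carr X"
  shows "0 \<le> fdist X (x, y)" "fdist X (x, y) \<le> 1"
proof -
  have "fdist X \<in> carr X \<times> carr X \<rightarrow>\<^sub>E {0..1}"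
    using assms(1) by (simp add: Obj_GMet)
  then have "fdist X (x, y) \<in> {0..1}"
    by (rule PiE_mem) (simp add: assms)
  then show "0 \<le> fdist X (x, y)" "fdist X (x, y) \<le> 1" by simp_all
qed

lemma Hom_GMet_mem: "f \<in> Hom (GMet H) X Y \<Longrightarrow> x \<in> carr X \<Longrightarrow> f x \<in> carr Y"
  by (auto simp: Hom_GMet)

lemma Hom_GMet_eqI:
  assumes "f \<in> Hom (GMet H) X Y" "g \<in> Hom (GMet H) X Y" "\<And>x. x \<in> carr X \<Longrightarrow> f x = g x"
  shows "f = g"
  using assms by (auto simp: Hom_GMet intro: PiE_ext)

lemma Comp_GMet_in_Hom:
  assumes "f \<in> Hom (GMet H) X Y" "g \<in> Hom (GMet H) Y Z"
  shows "compose (carr X) g f \<in> Hom (GMet H) X Z"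
proof -
  have "fdist Z (g (f x), g (f y)) \<le> fdist X (x, y)" if "x \<in> carr X" "y \<in> carr X" for x y
  proof -
    have "fdist Z (g (f x), g (f y)) \<le> fdist Y (f x, f y)"
      using assms that by (simp add: Hom_GMet nonexpansive_def PiE_iff)
    also have "\<dots> \<le> fdist X (x, y)"
      using assms that by (simp add: Hom_GMet nonexpansive_def)
    finally show ?thesis .
  qed
  with assms show ?thesis
    by (simp add: Hom_GMet nonexpansive_def compose_def PiE_iff)
qed

lemma Id_GMet_in_Hom: "(\<lambda>x\<in>carr X. x) \<in> Hom (GMet H) X X"
  by (simp add: Hom_GMet nonexpansive_def)

lemma Comp_GMet_Id:
  assumes "f \<in> Hom (GMet H) X Y"
  shows "compose (carr X) f (\<lambda>x\<in>carr X. x) = f" "compose (carr X) (\<lambda>y\<in>carr Y. y) f = f"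
  using assms by (auto simp: Hom_GMet PiE_def intro: compose_Id Id_compose)

lemma Comp_GMet_assoc:
  assumes "f \<in> Hom (GMet H) W X"
  shows "compose (carr W) (compose (carr X) h g) f = compose (carr W) h (compose (carr W) g f)"
  using assms by (intro compose_assoc[symmetric]) (auto simp: Hom_GMet)

lemma category_GMet: "is_category (GMet H)"
  unfolding is_category_def Id_GMet Comp_GMet
  by (intro conjI ballI Id_GMet_in_Hom)
    (assumption | rule Comp_GMet_in_Hom Comp_GMet_Id Comp_GMet_assoc)+

section \<open>The category of quantitative algebras\<close>

lemma map_in_tuples: "xs \<in> tuples n A \<Longrightarrow> (\<And>x. x \<in> A \<Longrightarrow> f x \<in> B) \<Longrightarrow> map f xs \<in> tuples n B"
  by (auto simp: tuples_def)

lemma Obj_QAlg: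
  "X \<in> Obj (QAlg \<Sigma> ar H) \<longleftrightarrow> qspace X \<in> Obj (GMet H) \<and>
    opn X \<in> (\<Pi>\<^sub>E s\<in>\<Sigma>. tuples (ar s) (carr (qspace X)) \<rightarrow>\<^sub>E carr (qspace X))"
  by (simp add: QAlg_def)

lemma Obj_QAlg_qspace: "X \<in> Obj (QAlg \<Sigma> ar H) \<Longrightarrow> qspace X \<in> Obj (GMet H)"
  by (simp add: Obj_QAlg)

lemma Obj_QAlg_opn:
  "X \<in> Obj (QAlg \<Sigma> ar H) \<Longrightarrow> s \<in> \<Sigma> \<Longrightarrow> xs \<in> tuples (ar s) (carr (qspace X))
    \<Longrightarrow> opn X s xs \<in> carr (qspace X)"
  by (auto simp: Obj_QAlg)

text \<open>The operations are extensional in the symbol and in the tuple, so their values elsewhere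
  are fixed by convention.\<close>

lemma Obj_QAlg_eqI:
  assumes "X \<in> Obj (QAlg \<Sigma> ar H)" "Y \<in> Obj (QAlg \<Sigma> ar H)" "qspace X = qspace Y"
    and "\<And>s xs. s \<in> \<Sigma> \<Longrightarrow> xs \<in> tuples (ar s) (carr (qspace X)) \<Longrightarrow> opn X s xs = opn Y s xs"
  shows "X = Y"
proof -
  have "opn X = opn Y"
  proof (rule PiE_ext)
    show "opn X \<in> (\<Pi>\<^sub>E s\<in>\<Sigma>. tuples (ar s) (carr (qspace X)) \<rightarrow>\<^sub>E carr (qspace X))"
      "opn Y \<in> (\<Pi>\<^sub>E s\<in>\<Sigma>. tuples (ar s) (carr (qspace X)) \<rightarrow>\<^sub>E carr (qspace X))"
      using assms(1-3) by (simp_all add: Obj_QAlg)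
    fix s assume "s \<in> \<Sigma>"
    with assms show "opn X s = opn Y s"
      by (intro PiE_ext[of _ "tuples (ar s) (carr (qspace X))" "\<lambda>_. carr (qspace X)"])
        (auto simp: Obj_QAlg)
  qed
  with assms(3) show ?thesis by simp
qed

lemma Hom_QAlg:
  "f \<in> Hom (QAlg \<Sigma> ar H) X Y \<longleftrightarrow> f \<in> Hom (GMet H) (qspace X) (qspace Y) \<and>
    (\<forall>s\<in>\<Sigma>. \<forall>xs\<in>tuples (ar s) (carr (qspace X)). f (opn X s xs) = opn Y s (map f xs))"
  by (simp add: QAlg_def)

lemma Hom_QAlg_GMet: "f \<in> Hom (QAlg \<Sigma> ar H) X Y \<Longrightarrow> f \<in> Hom (GMet H) (qspace X) (qspace Y)"
  by (simp add: Hom_QAlg)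

lemma Hom_QAlg_opn:
  "f \<in> Hom (QAlg \<Sigma> ar H) X Y \<Longrightarrow> s \<in> \<Sigma> \<Longrightarrow> xs \<in> tuples (ar s) (carr (qspace X))
    \<Longrightarrow> f (opn X s xs) = opn Y s (map f xs)"
  by (simp add: Hom_QAlg)

lemma Id_QAlg: "Id (QAlg \<Sigma> ar H) X = (\<lambda>x\<in>carr (qspace X). x)"
  by (simp add: QAlg_def Id_GMet)

lemma Comp_QAlg: "Comp (QAlg \<Sigma> ar H) X Y Z g f = compose (carr (qspace X)) g f"
  by (simp add: QAlg_def Comp_GMet)

lemma category_QAlg: "is_category (QAlg \<Sigma> ar H)"
proof -
  have Id: "(\<lambda>x\<in>carr (qspace X). x) \<in> Hom (QAlg \<Sigma> ar H) X X" if X: "X \<in> Obj (QAlg \<Sigma> ar H)" for X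
  proof -
    have "map (\<lambda>x\<in>carr (qspace X). x) xs = xs" if "xs \<in> tuples n (carr (qspace X))" for xs n
      using that by (intro map_idI) (auto simp: tuples_def)
    with X show ?thesis
      by (simp add: Hom_QAlg Obj_QAlg_opn Id_GMet_in_Hom)
  qed
  have Comp: "compose (carr (qspace X)) g f \<in> Hom (QAlg \<Sigma> ar H) X Z"
    if X: "X \<in> Obj (QAlg \<Sigma> ar H)" and f: "f \<in> Hom (QAlg \<Sigma> ar H) X Y" and g: "g \<in> Hom (QAlg \<Sigma> ar H) Y Z"
    for X Y Z f g
  proof -
    have "compose (carr (qspace X)) g f (opn X s xs) = opn Z s (map (compose (carr (qspace X)) g f) xs)"
      if s: "s \<in> \<Sigma>" and xs: "xs \<in> tuples (ar s) (carr (qspace X))" for s xs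
    proof -
      have "map f xs \<in> tuples (ar s) (carr (qspace Y))"
        using f xs by (blast intro: map_in_tuples Hom_GMet_mem Hom_QAlg_GMet)
      moreover have "map (compose (carr (qspace X)) g f) xs = map g (map f xs)"
        using xs by (auto simp: tuples_def compose_eq)
      ultimately show ?thesis
        using X f g s xs
          by (simp add: compose_eq Obj_QAlg_opn Hom_QAlg_opn del: map_map map_eq_conv)
    qed
    with f g show ?thesis
      by (auto simp: Hom_QAlg intro: Comp_GMet_in_Hom)
  qed
  show ?thesis
    unfolding is_category_def Id_QAlg Comp_QAlg
    by (intro conjI ballI Id)
      (assumption | rule Comp Comp_GMet_Id Comp_GMet_assoc Hom_QAlg_GMet)+
qed

lemma functor_forget_QAlg_GMet:
  "is_functor (QAlg \<Sigma> ar H) (GMet H) forget_QAlg_GMet"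
  unfolding is_functor_def
  by (simp add: category_QAlg category_GMet forget_QAlg_GMet_def Obj_QAlg Hom_QAlg)
    (simp add: QAlg_def)

lemma FO_forget: "FO forget_QAlg_GMet X = qspace X"
  and FA_forget: "FA forget_QAlg_GMet X Y f = f"
  by (simp_all add: forget_QAlg_GMet_def)

section \<open>Free quantitative algebras\<close>

lemma eval_in_carr:
  assumes "B \<in> Obj (QAlg \<Sigma> ar H)" "\<And>x. x \<in> V \<Longrightarrow> v x \<in> carr (qspace B)" "t \<in> terms \<Sigma> ar V"
  shows "eval v (opn B) t \<in> carr (qspace B)"
  using assms(3)
proof induction
  case (Op s ts)
  then show ?case
    using assms(1) by (auto intro!: Obj_QAlg_opn simp: tuples_def)
qed (use assms in simp)

lemma eval_cong:
  assumes "\<And>x. x \<in> V \<Longrightarrow> v x = v' x" "t \<in> terms \<Sigma> ar V"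
  shows "eval v f t = eval v' f t"
  using assms(2)
proof induction
  case (Op s ts)
  then have "map (eval v f) ts = map (eval v' f) ts" by simp
  then show ?case by (simp only: eval.simps)
qed (use assms in simp)

text \<open>Carriers must be small subsets of \<open>'u\<close>, whereas terms live in another type.
  The map \<open>code X\<close> transports the terms over \<open>X\<close> into \<open>'u\<close>
  with a small image.\<close>

locale coded_terms =
  fixes \<Sigma> :: "'s set" and ar :: "'s \<Rightarrow> nat" and H :: "horn set"
    and code :: "'u fspace \<Rightarrow> ('u, 's) tm \<Rightarrow> 'u"
  assumes wf: "\<forall>\<phi>\<in>H. wf_horn \<phi>"
    and inj_code: "\<And>X. X \<in> Obj (GMet H) \<Longrightarrow> inj_on (code X) (terms \<Sigma> ar (carr X))"
    and small_code: "\<And>X. X \<in> Obj (GMet H) \<Longrightarrow> small (code X ` terms \<Sigma> ar (carr X))"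
begin

abbreviation "C \<equiv> GMet H :: ('u fspace, 'u \<Rightarrow> 'u) cat"
abbreviation "D \<equiv> QAlg \<Sigma> ar H :: (('u, 's) qalg, 'u \<Rightarrow> 'u) cat"
abbreviation "T X \<equiv> terms \<Sigma> ar (carr X)"

text \<open>All algebras considered have carriers inside \<open>'u\<close>, so their interpretations
  form a set over which a supremum can be taken.\<close>

definition interps :: "'u fspace \<Rightarrow> (('u, 's) qalg \<times> ('u \<Rightarrow> 'u)) set" where
  "interps X = {(B, v). B \<in> Obj D \<and> v \<in> Hom C X (qspace B)}"

definition teq :: "'u fspace \<Rightarrow> ('u, 's) tm \<Rightarrow> ('u, 's) tm \<Rightarrow> bool" where
  "teq X t t' \<longleftrightarrow> (\<forall>B v. (B, v) \<in> interps X \<longrightarrow> eval v (opn B) t = eval v (opn B) t')"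

text \<open>The inserted \<open>0\<close> avoids the junk value \<open>Sup {}\<close>; distances are nonnegative, so it does not
  affect any other supremum.\<close>

definition tdist :: "'u fspace \<Rightarrow> ('u, 's) tm \<Rightarrow> ('u, 's) tm \<Rightarrow> real" where
  "tdist X t t' = Sup (insert 0
    ((\<lambda>(B, v). fdist (qspace B) (eval v (opn B) t, eval v (opn B) t')) ` interps X))"

text \<open>The quotient by \<open>teq X\<close> realised inside \<open>'u\<close>: a class is the
  code of one chosen member. Equivalent terms determine the same predicate under
  \<open>SOME\<close>, hence the same choice.\<close>

definition cls :: "'u fspace \<Rightarrow> ('u, 's) tm \<Rightarrow> 'u" where
  "cls X t = code X (SOME t'. t' \<in> T X \<and> teq X t t')"

definition rep :: "'u fspace \<Rightarrow> 'u \<Rightarrow> ('u, 's) tm" where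
  "rep X = inv_into (T X) (cls X)"

definition free :: "'u fspace \<Rightarrow> ('u, 's) qalg" where
  "free X =
    \<lparr>qspace = \<lparr>carr = cls X ` T X,
       fdist = (\<lambda>(a, b)\<in>cls X ` T X \<times> cls X ` T X. tdist X (rep X a) (rep X b))\<rparr>,
     opn = (\<lambda>s\<in>\<Sigma>. \<lambda>as\<in>tuples (ar s) (cls X ` T X). cls X (Op s (map (rep X) as)))\<rparr>"

definition eta :: "'u fspace \<Rightarrow> 'u \<Rightarrow> 'u" where
  "eta X = (\<lambda>x\<in>carr X. cls X (Var x))"

definition free_lift :: "'u fspace \<Rightarrow> ('u, 's) qalg \<Rightarrow> ('u \<Rightarrow> 'u) \<Rightarrow> 'u \<Rightarrow> 'u" where
  "free_lift X B v = (\<lambda>a\<in>cls X ` T X. eval v (opn B) (rep X a))"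

section \<open>Equivalence and distance of terms\<close>

lemma interps_eval_in_carr:
  "(B, v) \<in> interps X \<Longrightarrow> t \<in> T X \<Longrightarrow> eval v (opn B) t \<in> carr (qspace B)"
  by (rule eval_in_carr) (auto simp: interps_def intro: Hom_GMet_mem)

lemma teq_refl: "teq X t t"
  by (auto simp: teq_def)

lemma teq_sym: "teq X t t' \<Longrightarrow> teq X t' t"
  by (auto simp: teq_def)

lemma teq_trans: "teq X t t' \<Longrightarrow> teq X t' t'' \<Longrightarrow> teq X t t''"
  by (auto simp: teq_def)

lemma teq_Op: "list_all2 (teq X) ts ts' \<Longrightarrow> teq X (Op s ts) (Op s ts')"
proof -
  assume ts: "list_all2 (teq X) ts ts'"
  have "map (eval v (opn B)) ts = map (eval v (opn B)) ts'" if "(B, v) \<in> interps X" for B v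
    using ts by induction (use that in \<open>auto simp: teq_def\<close>)
  then show ?thesis by (auto simp: teq_def)
qed

lemma bdd_above_tdist:
  assumes "t \<in> T X" "t' \<in> T X"
  shows "bdd_above (insert 0
    ((\<lambda>(B, v). fdist (qspace B) (eval v (opn B) t, eval v (opn B) t')) ` interps X))"
  using assms interps_eval_in_carr
  by (intro bdd_aboveI[of _ 1])
    (auto simp: interps_def intro!: Obj_GMet_fdist(2) dest: Obj_QAlg_qspace)

text \<open>A supremum is bounded by \<open>e\<close> iff all its members are. The condition
  \<open>0 \<le> e\<close> accounts for the inserted \<open>0\<close>.\<close>

lemma tdist_le_iff:
  assumes "t \<in> T X" "t' \<in> T X" "0 \<le> e"
  shows "tdist X t t' \<le> e \<longleftrightarrow>
    (\<forall>B v. (B, v) \<in> interps X \<longrightarrow> fdist (qspace B) (eval v (opn B) t, eval v (opn B) t') \<le> e)"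
  using bdd_above_tdist[OF assms(1,2)] assms(3)
  unfolding tdist_def by (subst cSup_le_iff) auto

lemma tdist_bounds:
  assumes "t \<in> T X" "t' \<in> T X"
  shows "0 \<le> tdist X t t'" "tdist X t t' \<le> 1"
    and fdist_eval_le: "(B, v) \<in> interps X
      \<Longrightarrow> fdist (qspace B) (eval v (opn B) t, eval v (opn B) t') \<le> tdist X t t'"
proof -
  show "tdist X t t' \<le> 1"
    using assms interps_eval_in_carr
    by (auto simp: tdist_le_iff interps_def intro!: Obj_GMet_fdist(2) dest: Obj_QAlg_qspace)
  show "0 \<le> tdist X t t'"
    using bdd_above_tdist[OF assms] unfolding tdist_def by (intro cSup_upper) auto
  then show "fdist (qspace B) (eval v (opn B) t, eval v (opn B) t') \<le> tdist X t t'"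
    if "(B, v) \<in> interps X"
    using tdist_le_iff[OF assms, of "tdist X t t'"] that by auto
qed

lemma tdist_cong:
  assumes "teq X s s'" "teq X t t'"
  shows "tdist X s t = tdist X s' t'"
proof -
  have "(\<lambda>(B, v). fdist (qspace B) (eval v (opn B) s, eval v (opn B) t)) ` interps X
      = (\<lambda>(B, v). fdist (qspace B) (eval v (opn B) s', eval v (opn B) t')) ` interps X"
    using assms by (intro image_cong) (auto simp: teq_def)
  then show ?thesis unfolding tdist_def by simp
qed

section \<open>The free algebra and its universal property\<close>

lemma carr_qspace_free: "carr (qspace (free X)) = cls X ` T X"
  by (simp add: free_def)

context
  fixes X :: "'u fspace"
  assumes X: "X \<in> Obj C"
begin

text \<open>Injectivity of \<open>code X\<close> recovers the chosen member from the class, and two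
  terms with the same chosen member are equivalent to each other through it.\<close>

lemma cls_eq_iff:
  assumes "t \<in> T X" "t' \<in> T X"
  shows "cls X t = cls X t' \<longleftrightarrow> teq X t t'"
proof -
  let ?P = "\<lambda>t t'. t' \<in> T X \<and> teq X t t'"
  have some: "?P t (SOME t'. ?P t t')" if "t \<in> T X" for t
    by (rule someI[of "?P t" t]) (use that teq_refl in auto)
  show ?thesis
  proof
    assume "cls X t = cls X t'"
    then have "(SOME s. ?P t s) = (SOME s. ?P t' s)"
      using inj_onD[OF inj_code[OF X]] some[OF assms(1)] some[OF assms(2)]
      unfolding cls_def by blast
    then show "teq X t t'"
      using some[OF assms(1)] some[OF assms(2)] teq_sym teq_trans by metis
  next
    assume "teq X t t'"
    then have "?P t = ?P t'" using teq_sym teq_trans by (intro ext) blast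
    then show "cls X t = cls X t'" by (simp add: cls_def)
  qed
qed

lemma rep:
  assumes "a \<in> cls X ` T X"
  shows "rep X a \<in> T X" "cls X (rep X a) = a"
  using assms by (auto simp: rep_def inv_into_into f_inv_into_f)

lemma teq_rep_cls: "t \<in> T X \<Longrightarrow> teq X (rep X (cls X t)) t"
  using cls_eq_iff rep by blast

lemma fdist_free:
  "t \<in> T X \<Longrightarrow> t' \<in> T X \<Longrightarrow> fdist (qspace (free X)) (cls X t, cls X t') = tdist X t t'"
  by (simp add: free_def) (blast intro: tdist_cong teq_rep_cls)

text \<open>The operations are defined on the representatives picked by \<open>rep X\<close>; since
  \<open>teq X\<close> is a congruence by \<open>teq_Op\<close>, any other representatives
  \<open>ts\<close> give the same class.\<close>

lemma opn_free:
  assumes "s \<in> \<Sigma>" "length ts = ar s" "\<forall>t\<in>set ts. t \<in> T X"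
  shows "opn (free X) s (map (cls X) ts) = cls X (Op s ts)"
proof -
  let ?ts = "map (rep X) (map (cls X) ts)"
  have "map (cls X) ts \<in> tuples (ar s) (cls X ` T X)"
    using assms by (auto simp: tuples_def)
  then have "opn (free X) s (map (cls X) ts) = cls X (Op s ?ts)"
    using assms by (simp add: free_def)
  also have "\<dots> = cls X (Op s ts)"
  proof (subst cls_eq_iff)
    show "Op s ?ts \<in> T X" "Op s ts \<in> T X"
      using assms rep by (auto intro!: terms.Op)
    show "teq X (Op s ?ts) (Op s ts)"
      by (rule teq_Op) (use assms in \<open>auto simp: list_all2_conv_all_nth teq_rep_cls\<close>)
  qed
  finally show ?thesis .
qed

lemma free_carr_cases:
  assumes "a \<in> carr (qspace (free X))"
  obtains t where "t \<in> T X" "a = cls X t"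
  using assms by (auto simp: free_def)

lemma free_tuples_cases:
  assumes "as \<in> tuples n (carr (qspace (free X)))"
  obtains ts where "length ts = n" "\<forall>t\<in>set ts. t \<in> T X" "as = map (cls X) ts"
proof
  show "length (map (rep X) as) = n" "\<forall>t\<in>set (map (rep X) as). t \<in> T X" "as = map (cls X) (map (rep X) as)"
    using assms rep by (auto simp: tuples_def free_def map_idI subset_iff)
qed

lemma sat_horn_free:
  assumes "\<phi> \<in> H"
  shows "sat_horn (qspace (free X)) \<phi>"
proof (cases \<phi>)
  case (Horn Fs G)
  have wf_atoms: "wf_atom G" "\<forall>F\<in>set Fs. wf_atom F"
    using wf assms Horn by auto
  have "sat_atom (qspace (free X)) w G"
    if w: "range w \<subseteq> carr (qspace (free X))" and Fs: "\<forall>F\<in>set Fs. sat_atom (qspace (free X)) w F" for w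
  proof -
    \<comment> \<open>Representing terms turn the valuation \<open>w\<close> into a valuation in
      every algebra \<open>B\<close> at once, by evaluation under \<open>v\<close>.\<close>
    define \<tau> where "\<tau> = rep X \<circ> w"
    have "w n \<in> cls X ` T X" for n
      using w by (auto simp: carr_qspace_free)
    then have \<tau>: "\<tau> n \<in> T X" "w n = cls X (\<tau> n)" for n
      by (simp_all add: \<tau>_def rep)
    \<comment> \<open>Equality atoms amount to \<open>teq\<close>, distance atoms to
      \<open>tdist_le_iff\<close>; well-formedness supplies the bound \<open>0 \<le> e\<close>
      required there.\<close>
    have sat_iff: "sat_atom (qspace (free X)) w F \<longleftrightarrow>
        (\<forall>B v. (B, v) \<in> interps X \<longrightarrow> sat_atom (qspace B) (\<lambda>n. eval v (opn B) (\<tau> n)) F)" if "wf_atom F" for F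
      using that by (cases F) (auto simp: \<tau> cls_eq_iff teq_def fdist_free tdist_le_iff)
    have "sat_atom (qspace B) (\<lambda>n. eval v (opn B) (\<tau> n)) G" if Bv: "(B, v) \<in> interps X" for B v
    proof -
      have "sat_horn (qspace B) \<phi>"
        using Bv assms by (auto simp: interps_def Obj_QAlg Obj_GMet)
      moreover have "range (\<lambda>n. eval v (opn B) (\<tau> n)) \<subseteq> carr (qspace B)"
        using interps_eval_in_carr[OF Bv] \<tau> by auto
      moreover have "\<forall>F\<in>set Fs. sat_atom (qspace B) (\<lambda>n. eval v (opn B) (\<tau> n)) F"
        using Fs wf_atoms sat_iff Bv by fastforce
      ultimately show ?thesis by (simp add: Horn)
    qed
    then show ?thesis using wf_atoms sat_iff by auto
  qed
  then show ?thesis by (simp add: Horn)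
qed

lemma free_in_Obj: "free X \<in> Obj D"
proof -
  \<comment> \<open>Every class is the code of some term, so the carrier inherits smallness from the
    coded terms.\<close>
  have "cls X ` T X \<subseteq> code X ` T X"
  proof
    fix a assume "a \<in> cls X ` T X"
    then obtain t where t: "t \<in> T X" "a = cls X t" by blast
    have "(SOME t'. t' \<in> T X \<and> teq X t t') \<in> T X"
      by (rule someI2[of _ t]) (use t teq_refl in auto)
    with t show "a \<in> code X ` T X" by (simp add: cls_def)
  qed
  then have "small (cls X ` T X)"
    using small_code[OF X] unfolding small_def
    by (blast intro: lesspoll_trans1 subset_imp_lepoll)
  moreover have "fdist (qspace (free X)) \<in> cls X ` T X \<times> cls X ` T X \<rightarrow>\<^sub>E {0..1}"
    by (auto simp: free_def rep tdist_bounds)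
  ultimately have "qspace (free X) \<in> Obj C"
    using sat_horn_free by (simp add: Obj_GMet carr_qspace_free)
  moreover have "cls X (Op s (map (rep X) as)) \<in> cls X ` T X"
    if "s \<in> \<Sigma>" "as \<in> tuples (ar s) (cls X ` T X)" for s as
    using that rep by (intro imageI terms.Op) (auto simp: tuples_def)
  ultimately show ?thesis
    by (auto simp: Obj_QAlg free_def)
qed

text \<open>Each interpretation of \<open>X\<close> is nonexpansive, so the distance in
  \<open>X\<close> bounds all members of the supremum defining \<open>tdist\<close> on
  variables.\<close>

lemma eta_in_Hom: "eta X \<in> Hom C X (qspace (free X))"
proof -
  have "tdist X (Var x) (Var y) \<le> fdist X (x, y)" if "x \<in> carr X" "y \<in> carr X" for x y
    using that Obj_GMet_fdist[OF X]
    by (subst tdist_le_iff)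
      (auto simp: interps_def Hom_GMet nonexpansive_def intro: terms.Var)
  then show ?thesis
    by (auto simp: Hom_GMet eta_def nonexpansive_def fdist_free carr_qspace_free terms.Var)
qed

lemma free_lift_cls:
  assumes "B \<in> Obj D" "v \<in> Hom C X (qspace B)" "t \<in> T X"
  shows "free_lift X B v (cls X t) = eval v (opn B) t"
  using assms teq_rep_cls[of t] by (auto simp: free_lift_def teq_def interps_def)

text \<open>The map is nonexpansive because the distance in \<open>B\<close> under \<open>v\<close>
  is one of the members of the supremum.\<close>

lemma free_lift_in_Hom:
  assumes B: "B \<in> Obj D" and v: "v \<in> Hom C X (qspace B)"
  shows "free_lift X B v \<in> Hom D (free X) B"
proof -
  note cls = free_lift_cls[OF assms]
  have Bv: "(B, v) \<in> interps X" using assms by (simp add: interps_def)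
  have "free_lift X B v \<in> carr (qspace (free X)) \<rightarrow>\<^sub>E carr (qspace B)"
    using interps_eval_in_carr[OF Bv] rep by (auto simp: free_lift_def free_def)
  moreover have "nonexpansive (qspace (free X)) (qspace B) (free_lift X B v)"
    using fdist_eval_le[OF _ _ Bv]
    by (auto simp: nonexpansive_def cls fdist_free elim!: free_carr_cases)
  moreover have "free_lift X B v (opn (free X) s as) = opn B s (map (free_lift X B v) as)"
    if s: "s \<in> \<Sigma>" and as: "as \<in> tuples (ar s) (carr (qspace (free X)))" for s as
    using as
  proof (rule free_tuples_cases)
    fix ts assume ts: "length ts = ar s" "\<forall>t\<in>set ts. t \<in> T X" "as = map (cls X) ts"
    then have "map (free_lift X B v) as = map (eval v (opn B)) ts"
      by (simp add: cls)
    moreover have "free_lift X B v (opn (free X) s as) = opn B s (map (eval v (opn B)) ts)"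
      using ts s by (simp add: opn_free cls terms.Op)
    ultimately show ?thesis by simp
  qed
  ultimately show ?thesis by (auto simp: Hom_QAlg Hom_GMet)
qed

text \<open>The variables generate the free algebra, so induction on terms determines a homomorphism
  by its values on them. The uniqueness half of the universal property rests on this.\<close>

lemma Hom_free_cls:
  assumes f: "f \<in> Hom D (free X) B" and t: "t \<in> T X"
  shows "f (cls X t) = eval (\<lambda>x. f (cls X (Var x))) (opn B) t"
  using t
proof induction
  case (Op s ts)
  have ts: "map (cls X) ts \<in> tuples (ar s) (carr (qspace (free X)))"
    using Op by (auto simp: tuples_def free_def)
  have "f (cls X (Op s ts)) = f (opn (free X) s (map (cls X) ts))"
    using Op by (subst opn_free) auto
  also have "\<dots> = opn B s (map f (map (cls X) ts))"
    by (rule Hom_QAlg_opn[OF f \<open>s \<in> \<Sigma>\<close> ts])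
  also have "map f (map (cls X) ts) = map (eval (\<lambda>x. f (cls X (Var x))) (opn B)) ts"
    using Op by simp
  finally show ?case by simp
qed simp

end

sublocale universal_arrows C D forget_QAlg_GMet free eta free_lift
proof
  show "is_functor D C forget_QAlg_GMet" by (rule functor_forget_QAlg_GMet)
next
  fix X :: "'u fspace" assume X: "X \<in> Obj C"
  show "free X \<in> Obj D" by (rule free_in_Obj[OF X])
  show "eta X \<in> Hom C X (FO forget_QAlg_GMet (free X))"
    using eta_in_Hom[OF X] by (simp add: FO_forget FA_forget)
next
  fix X :: "'u fspace" and B :: "('u, 's) qalg" and v
  assume X: "X \<in> Obj C" and B: "B \<in> Obj D" and v': "v \<in> Hom C X (FO forget_QAlg_GMet B)"
  then have v: "v \<in> Hom C X (qspace B)" by (simp add: FO_forget FA_forget)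
  show lift: "free_lift X B v \<in> Hom D (free X) B" by (rule free_lift_in_Hom[OF X B v])
  have "compose (carr X) (free_lift X B v) (eta X) = v"
  proof (rule Hom_GMet_eqI[OF _ v])
    show "compose (carr X) (free_lift X B v) (eta X) \<in> Hom C X (qspace B)"
      by (rule Comp_GMet_in_Hom[OF eta_in_Hom[OF X] Hom_QAlg_GMet[OF lift]])
  qed (simp add: compose_eq eta_def free_lift_cls[OF X B v] terms.Var)
  then show "Comp C X (FO forget_QAlg_GMet (free X)) (FO forget_QAlg_GMet B)
      (FA forget_QAlg_GMet (free X) B (free_lift X B v)) (eta X) = v"
    by (simp add: FO_forget FA_forget Comp_GMet)
next
  fix X :: "'u fspace" and B :: "('u, 's) qalg" and g
  assume X: "X \<in> Obj C" and B: "B \<in> Obj D" and g: "g \<in> Hom D (free X) B"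
  let ?v = "compose (carr X) g (eta X)"
  have v: "?v \<in> Hom C X (qspace B)"
    by (rule Comp_GMet_in_Hom[OF eta_in_Hom[OF X] Hom_QAlg_GMet[OF g]])
  have "free_lift X B ?v = g"
  proof (rule Hom_GMet_eqI[OF Hom_QAlg_GMet[OF free_lift_in_Hom[OF X B v]] Hom_QAlg_GMet[OF g]])
    fix a assume "a \<in> carr (qspace (free X))"
    then obtain t where t: "t \<in> T X" "a = cls X t" by (rule free_carr_cases[OF X])
    \<comment> \<open>The two valuations are only known to agree on \<open>carr X\<close>, where all
      variables of \<open>t\<close> lie.\<close>
    have "eval ?v (opn B) t = eval (\<lambda>x. g (cls X (Var x))) (opn B) t"
      by (rule eval_cong[OF _ t(1)]) (simp add: compose_eq eta_def)
    then show "free_lift X B ?v a = g a"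
      using t by (simp add: free_lift_cls[OF X B v] Hom_free_cls[OF X g])
  qed
  then show "free_lift X B (Comp C X (FO forget_QAlg_GMet (free X)) (FO forget_QAlg_GMet B)
      (FA forget_QAlg_GMet (free X) B g) (eta X)) = g"
    by (simp add: FO_forget FA_forget Comp_GMet)
qed

section \<open>The adjunction on elements\<close>

lemma left_adjoint_in_Hom:
  assumes "X \<in> Obj C" "Y \<in> Obj C" "f \<in> Hom C X Y"
  shows "FA left_adjoint X Y f \<in> Hom D (free X) (free Y)"
  using assms by (rule FA_left_adjoint_in_Hom)

lemma left_adjoint_eta_apply:
  assumes "X \<in> Obj C" "Y \<in> Obj C" "f \<in> Hom C X Y" "x \<in> carr X"
  shows "FA left_adjoint X Y f (eta X x) = eta Y (f x)"
  using fun_cong[OF FA_left_adjoint_eta[OF assms(1-3)], of x] assms(4)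
  by (simp add: FO_forget FA_forget Comp_GMet compose_eq)

lemma counit_in_Hom':
  "Y \<in> Obj D \<Longrightarrow> counit Y \<in> Hom D (free (qspace Y)) Y"
  using counit_in_Hom by (simp add: FO_forget FA_forget)

lemma counit_eta_apply:
  assumes "Y \<in> Obj D" "y \<in> carr (qspace Y)"
  shows "counit Y (eta (qspace Y) y) = y"
  using fun_cong[OF counit_eta[OF assms(1)], of y] assms(2)
  by (simp add: FO_forget FA_forget Comp_GMet Id_GMet compose_eq)

lemma eta_mem: "X \<in> Obj C \<Longrightarrow> x \<in> carr X \<Longrightarrow> eta X x \<in> carr (qspace (free X))"
  by (rule Hom_GMet_mem[OF eta_in_Hom])

text \<open>The counit is a homomorphism and sends generators back to themselves. Hence it
  determines the operations of \<open>Y\<close>, which is what lets the comparison functor reflect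
  algebra structure.\<close>

lemma counit_opn_eta:
  assumes "Y \<in> Obj D" "s \<in> \<Sigma>" "xs \<in> tuples (ar s) (carr (qspace Y))"
  shows "counit Y (opn (free (qspace Y)) s (map (eta (qspace Y)) xs)) = opn Y s xs"
proof -
  have "map (eta (qspace Y)) xs \<in> tuples (ar s) (carr (qspace (free (qspace Y))))"
    using assms by (auto intro!: map_in_tuples eta_mem Obj_QAlg_qspace)
  then have "counit Y (opn (free (qspace Y)) s (map (eta (qspace Y)) xs))
      = opn Y s (map (counit Y) (map (eta (qspace Y)) xs))"
    using assms by (intro Hom_QAlg_opn[OF counit_in_Hom'])
  also have "map (counit Y) (map (eta (qspace Y)) xs) = xs"
    using assms by (auto simp: tuples_def counit_eta_apply intro!: map_idI)
  finally show ?thesis .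
qed

section \<open>Invertibility of the comparison functor\<close>

abbreviation "M \<equiv> adj_monad left_adjoint forget_QAlg_GMet eta counit"
abbreviation "K \<equiv> comparison_functor left_adjoint forget_QAlg_GMet counit"

lemma FO_comparison: "FO K Y = (qspace Y, counit Y)"
  by (simp add: comparison_functor_def FO_forget FA_forget)

lemma FA_comparison: "FA K X Y f = f"
  by (simp add: comparison_functor_def FO_forget FA_forget)

lemma Obj_EM: "(A, \<alpha>) \<in> Obj (EM C M) \<longleftrightarrow>
    A \<in> Obj C \<and> \<alpha> \<in> Hom C (qspace (free A)) A \<and> compose (carr A) \<alpha> (eta A) = (\<lambda>x\<in>carr A. x) \<and>
    compose (carr (qspace (free (qspace (free A))))) \<alpha> (counit (free A))
      = compose (carr (qspace (free (qspace (free A))))) \<alpha>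
          (FA left_adjoint (qspace (free A)) A \<alpha>)"
  by (simp add: EM_def adj_monad_def comp_functor_def FO_forget FA_forget Comp_GMet Id_GMet)

lemma Hom_EM: "h \<in> Hom (EM C M) (A, \<alpha>) (B, \<beta>) \<longleftrightarrow>
    h \<in> Hom C A B \<and> compose (carr (qspace (free A))) h \<alpha>
      = compose (carr (qspace (free A))) \<beta> (FA left_adjoint A B h)"
  by (simp add: EM_def adj_monad_def comp_functor_def FO_forget FA_forget Comp_GMet)

definition EM_qalg :: "'u fspace \<Rightarrow> ('u \<Rightarrow> 'u) \<Rightarrow> ('u, 's) qalg" where
  "EM_qalg A \<alpha> = \<lparr>qspace = A,
    opn = (\<lambda>s\<in>\<Sigma>. \<lambda>xs\<in>tuples (ar s) (carr A). \<alpha> (opn (free A) s (map (eta A) xs)))\<rparr>"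

text \<open>Once \<alpha> is a homomorphism out of the free algebra, the unit law says that it
  restricts to the identity along \<open>eta A\<close>. The counit is the unique such
  homomorphism.\<close>

lemma EM_qalg:
  assumes "(A, \<alpha>) \<in> Obj (EM C M)"
  shows EM_qalg_in_Obj: "EM_qalg A \<alpha> \<in> Obj D" and counit_EM_qalg: "counit (EM_qalg A \<alpha>) = \<alpha>"
proof -
  let ?F = "free A" and ?Y = "EM_qalg A \<alpha>"
  let ?FA = "qspace ?F"
  let ?T\<alpha> = "FA left_adjoint ?FA A \<alpha>"
  have A: "A \<in> Obj C" and \<alpha>: "\<alpha> \<in> Hom C ?FA A"
    and unit: "compose (carr A) \<alpha> (eta A) = (\<lambda>x\<in>carr A. x)"
    and assoc: "compose (carr (qspace (free ?FA))) \<alpha> (counit ?F)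
      = compose (carr (qspace (free ?FA))) \<alpha> ?T\<alpha>"
    using assms by (auto simp: Obj_EM)
  have F: "?F \<in> Obj D" by (rule free_in_Obj[OF A])
  have FA: "?FA \<in> Obj C" by (rule Obj_QAlg_qspace[OF F])
  have FF: "free ?FA \<in> Obj D" by (rule free_in_Obj[OF FA])
  have eta_tuples: "map (eta X) xs \<in> tuples n (carr (qspace (free X)))"
    if "X \<in> Obj C" "xs \<in> tuples n (carr X)" for X n xs
    using that by (auto intro: map_in_tuples eta_mem)
  show Y: "?Y \<in> Obj D"
    using A Hom_GMet_mem[OF \<alpha>] Obj_QAlg_opn[OF F] eta_tuples[OF A]
    by (auto simp: Obj_QAlg EM_qalg_def)
  have "\<alpha> (opn ?F s ts) = opn ?Y s (map \<alpha> ts)"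
    if s: "s \<in> \<Sigma>" and ts: "ts \<in> tuples (ar s) (carr ?FA)" for s ts
  proof -
    \<comment> \<open>The formal operation \<open>s\<close> on the elements \<open>ts\<close> of the
      free algebra, taken as new generators. The counit flattens it to \<open>opn ?F s ts\<close>,
      while \<open>?T\<alpha>\<close> applies \<alpha> to each generator; associativity identifies
      the two after applying \<alpha>.\<close>
    let ?u = "opn (free ?FA) s (map (eta ?FA) ts)"
    have u: "?u \<in> carr (qspace (free ?FA))"
      by (rule Obj_QAlg_opn[OF FF s eta_tuples[OF FA ts]])
    have "\<alpha> (opn ?F s ts) = \<alpha> (counit ?F ?u)"
      by (simp add: counit_opn_eta[OF F s ts])
    also have "\<dots> = \<alpha> (?T\<alpha> ?u)"
      using fun_cong[OF assoc, of ?u] u by (simp add: compose_eq)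
    also have "?T\<alpha> ?u = opn ?F s (map ?T\<alpha> (map (eta ?FA) ts))"
      by (rule Hom_QAlg_opn[OF left_adjoint_in_Hom[OF FA A \<alpha>] s eta_tuples[OF FA ts]])
    also have "map ?T\<alpha> (map (eta ?FA) ts) = map (eta A) (map \<alpha> ts)"
      using ts by (auto simp: tuples_def left_adjoint_eta_apply[OF FA A \<alpha>])
    also have "\<alpha> (opn ?F s (map (eta A) (map \<alpha> ts))) = opn ?Y s (map \<alpha> ts)"
    proof -
      have "map \<alpha> ts \<in> tuples (ar s) (carr A)"
        using ts Hom_GMet_mem[OF \<alpha>] by (auto intro: map_in_tuples)
      with s show ?thesis by (simp add: EM_qalg_def)
    qed
    finally show ?thesis .
  qed
  then have hom: "\<alpha> \<in> Hom D ?F ?Y"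
    using \<alpha> by (simp add: Hom_QAlg EM_qalg_def)
  have qY: "qspace ?Y = A" by (simp add: EM_qalg_def)
  show "counit ?Y = \<alpha>"
    using counit_in_Hom[OF Y] counit_eta[OF Y] unit
    by (intro lift_eqI[OF A Y _ hom]) (simp_all add: FO_forget FA_forget qY Comp_GMet Id_GMet)
qed

text \<open>Injectivity holds because the counit determines the operations by
  \<open>counit_opn_eta\<close>; \<open>EM_qalg\<close> provides preimages.\<close>

lemma bij_betw_Obj_comparison: "bij_betw (FO K) (Obj D) (Obj (EM C M))"
  unfolding bij_betw_def
proof
  show "inj_on (FO K) (Obj D)"
  proof (rule inj_onI)
    fix Y Z assume Y: "Y \<in> Obj D" and Z: "Z \<in> Obj D" and eq: "FO K Y = FO K Z"
    then have q: "qspace Y = qspace Z" and c: "counit Y = counit Z"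
      by (simp_all add: FO_comparison)
    show "Y = Z"
      using Y Z q
    proof (rule Obj_QAlg_eqI)
      fix s xs assume "s \<in> \<Sigma>" "xs \<in> tuples (ar s) (carr (qspace Y))"
      then show "opn Y s xs = opn Z s xs"
        using counit_opn_eta[OF Y, of s xs] counit_opn_eta[OF Z, of s xs] q c by simp
    qed
  qed
  show "FO K ` Obj D = Obj (EM C M)"
  proof
    show "FO K ` Obj D \<subseteq> Obj (EM C M)"
      using functor_Obj[OF functor_comparison_functor[OF adjunction]] by blast
    show "Obj (EM C M) \<subseteq> FO K ` Obj D"
    proof
      fix P assume P: "P \<in> Obj (EM C M)"
      obtain A \<alpha> where [simp]: "P = (A, \<alpha>)" by fastforce
      have "FO K (EM_qalg A \<alpha>) = P"
        using P by (simp add: FO_comparison counit_EM_qalg) (simp add: EM_qalg_def)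
      with P show "P \<in> FO K ` Obj D"
        using EM_qalg_in_Obj by force
    qed
  qed
qed

text \<open>The nontrivial inclusion evaluates the Eilenberg-Moore square of \<open>h\<close> at the
  formal operation \<open>s\<close> on generators: its two sides give the two sides of the
  homomorphism equation.\<close>

lemma Hom_EM_comparison:
  assumes Y: "Y \<in> Obj D" and Z: "Z \<in> Obj D"
  shows "Hom (EM C M) (FO K Y) (FO K Z) = Hom D Y Z"
proof
  show "Hom D Y Z \<subseteq> Hom (EM C M) (FO K Y) (FO K Z)"
    using functor_Hom[OF functor_comparison_functor[OF adjunction] Y Z] by (auto simp: FA_comparison)
  show "Hom (EM C M) (FO K Y) (FO K Z) \<subseteq> Hom D Y Z"
  proof
    fix h assume "h \<in> Hom (EM C M) (FO K Y) (FO K Z)"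
    then have h: "h \<in> Hom C (qspace Y) (qspace Z)"
      and alg: "compose (carr (qspace (free (qspace Y)))) h (counit Y)
        = compose (carr (qspace (free (qspace Y)))) (counit Z) (FA left_adjoint (qspace Y) (qspace Z) h)"
      by (simp_all add: FO_comparison Hom_EM)
    have A: "qspace Y \<in> Obj C" and B: "qspace Z \<in> Obj C"
      using Y Z by (auto intro: Obj_QAlg_qspace)
    have "h (opn Y s xs) = opn Z s (map h xs)"
      if s: "s \<in> \<Sigma>" and xs: "xs \<in> tuples (ar s) (carr (qspace Y))" for s xs
    proof -
      let ?e = "eta (qspace Y)" and ?Th = "FA left_adjoint (qspace Y) (qspace Z) h"
      let ?u = "opn (free (qspace Y)) s (map ?e xs)"
      have e: "map ?e xs \<in> tuples (ar s) (carr (qspace (free (qspace Y))))"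
        using xs A by (auto intro: map_in_tuples eta_mem)
      have u: "?u \<in> carr (qspace (free (qspace Y)))"
        by (rule Obj_QAlg_opn[OF free_in_Obj[OF A] s e])
      have "h (opn Y s xs) = h (counit Y ?u)"
        by (simp add: counit_opn_eta[OF Y s xs])
      also have "\<dots> = counit Z (?Th ?u)"
        using fun_cong[OF alg, of ?u] u by (simp add: compose_eq)
      also have "?Th ?u = opn (free (qspace Z)) s (map ?Th (map ?e xs))"
        by (rule Hom_QAlg_opn[OF left_adjoint_in_Hom[OF A B h] s e])
      also have "map ?Th (map ?e xs) = map (eta (qspace Z)) (map h xs)"
        using xs by (auto simp: tuples_def left_adjoint_eta_apply[OF A B h])
      also have "counit Z (opn (free (qspace Z)) s (map (eta (qspace Z)) (map h xs))) = opn Z s (map h xs)"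
        using xs Hom_GMet_mem[OF h] by (intro counit_opn_eta[OF Z s] map_in_tuples)
      finally show ?thesis .
    qed
    with h show "h \<in> Hom D Y Z" by (simp add: Hom_QAlg)
  qed
qed

lemma strictly_monadic_forget: "strictly_monadic D C forget_QAlg_GMet"
proof -
  have "is_iso_of_categories D (EM C M) K"
  proof (rule is_iso_of_categories_if_bij_betw)
    show "is_functor D (EM C M) K"
      by (rule functor_comparison_functor[OF adjunction])
    show "bij_betw (FO K) (Obj D) (Obj (EM C M))"
      by (rule bij_betw_Obj_comparison)
    show "bij_betw (FA K Y Z) (Hom D Y Z) (Hom (EM C M) (FO K Y) (FO K Z))"
      if "Y \<in> Obj D" "Z \<in> Obj D" for Y Z
      using that by (simp add: Hom_EM_comparison FA_comparison bij_betw_def inj_on_def)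
  qed
  then show ?thesis
    unfolding strictly_monadic_def using adjunction by blast
qed

end

theorem mainTheorem15:
  fixes \<Sigma> :: "'s set" and ar :: "'s \<Rightarrow> nat" and H :: "horn set"
  assumes "uncountable (UNIV :: 'u set)"
    and "\<Sigma> \<prec> (UNIV :: 'u set)"
    and "\<forall>\<phi>\<in>H. wf_horn \<phi>"
    and "has_discrete_finite_products TYPE('u) H"
  shows "strictly_monadic (QAlg \<Sigma> ar H :: (('u, 's) qalg, 'u \<Rightarrow> 'u) cat) (GMet H) forget_QAlg_GMet"
proof -
  \<comment> \<open>The terms over a small carrier are fewer than the elements of \<open>'u\<close>,
    so an injection into \<open>'u\<close> exists and its image is again small. One injection is
    then chosen for each space.\<close>
  have "\<exists>c :: ('u, 's) tm \<Rightarrow> 'u. inj_on c (terms \<Sigma> ar (carr X)) \<and> small (c ` terms \<Sigma> ar (carr X))"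
    if "X \<in> Obj (GMet H)" for X :: "'u fspace"
  proof -
    have "terms \<Sigma> ar (carr X) \<prec> (UNIV :: 'u set)"
      using that assms(1,2) by (intro terms_lesspoll) (auto simp: Obj_GMet small_def)
    moreover from this obtain c :: "('u, 's) tm \<Rightarrow> 'u" where "inj_on c (terms \<Sigma> ar (carr X))"
      unfolding lesspoll_def lepoll_def by blast
    ultimately show ?thesis
      unfolding small_def by (blast intro: lesspoll_trans1 image_lepoll)
  qed
  then obtain code :: "'u fspace \<Rightarrow> ('u, 's) tm \<Rightarrow> 'u" where
    "\<And>X. X \<in> Obj (GMet H) \<Longrightarrow> inj_on (code X) (terms \<Sigma> ar (carr X))
      \<and> small (code X ` terms \<Sigma> ar (carr X))"
    by metis
  then interpret coded_terms \<Sigma> ar H code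
    using assms(3) by unfold_locales auto
  show ?thesis by (rule strictly_monadic_forget)
qed

end
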